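(* Let $\mathbf{k}$ be an algebraically closed field of characteristic zero, $A=\mathbf{k}[x,y,z]/\langle x^2+y^2+z^2-1\rangle$ and $\mathcal{V}=\mathrm{Der}_{\mathbf{k}}(A)$. Let $M$ be a tensor module on $\mathbb{S}^2$ corresponding to a simple rational $\mathrm{GL}_2$-module $U$. Then $M$ is a simple $A\mathcal{V}$-module.
   Context: An $A\mathcal{V}$-module is a $\mathbf{k}$-vector space $M$ that is both a module over the commutative unital algebra $A$ and a module over the Lie algebra $\mathcal{V}$, such that $\eta\cdot(a\cdot m)=\eta(a)\cdot m+a\cdot(\eta\cdot m)$ for all $a\in A$, $\eta\in\mathcal{V}$, $m\in M$. Morphisms and submodules respect both structures. Charts. For $h\in\{x,y,z\}$ let $A_{(h)}=A[h^{-1}]$ be the localization. The chart parameters $(t_1,t_2)$ of the chart $N(h)=\{P\in\mathbb{S}^2: h(P)\neq0\}$ are the two coordinates other than $h$: $(y,z)$ for $h=x$, $(x,z)$ for $h=y$, $(x,y)$ for $h=z$. The derivations $\frac{\partial}{\partial t_1},\frac{\partial}{\partial t_2}$ of $\mathbf{k}[t_1,t_2]\subset A$ extend uniquely to derivations of $A_{(h)}$ (for instance for $h=z$: $\frac{\partial z}{\partial x}=-\frac{x}{z}$, $\frac{\partial z}{\partial y}=-\frac{y}{z}$), and $\mathrm{Der}(A_{(h)})=A_{(h)}\frac{\partial}{\partial t_1}\oplus A_{(h)}\frac{\partial}{\partial t_2}$. Every $\eta\in\mathcal{V}$ extends uniquely to $A_{(h)}$, so $\mathcal{V}\subset\mathrm{Der}(A_{(h)})$.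 For a finite-dimensional $\mathfrak{gl}_2$-module $U$, the space $A_{(h)}\otimes_{\mathbf{k}}U$ is an $A\mathcal{V}$-module: $A$ acts by multiplication on the left factor, and $$\Big(\sum_{i=1}^{2}f_i\frac{\partial}{\partial t_i}\Big)\cdot(g\otimes u)=\sum_{i=1}^{2}f_i\frac{\partial g}{\partial t_i}\otimes u+\sum_{p=1}^{2}\sum_{i=1}^{2}g\frac{\partial f_i}{\partial t_p}\otimes(E_{p,i}\cdot u),$$ where $E_{p,i}$ are the matrix units of $\mathfrak{gl}_2$. A rational $\mathrm{GL}_2$-module is regarded as a $\mathfrak{gl}_2$-module by differentiation. Change of charts. Let $V$ be the natural module of $\mathrm{GL}_2$ with basis $e_1,e_2$ ($E_{p,i}e_j=\delta_{ij}e_p$), and regard $\mathrm{GL}_2=\mathrm{GL}(V)$. For charts $N(h)$, $N(\tilde h)$ with chart parameters $(t_1,t_2)$, $(\tilde t_1,\tilde t_2)$, write $A_{(h,\tilde h)}$ for the localization of $A$ at both $h$ and $\tilde h$, and let $C$ be the invertible $A_{(h,\tilde h)}$-linear map of $A_{(h,\tilde h)}\otimes V$ given by $Ce_i=\sum_{j=1}^{2}\frac{\partial t_i}{\partial\tilde t_j}e_j$. For a finite-dimensional rational representation $\rho:\mathrm{GL}_2\to\mathrm{GL}(U)$, $\rho(C)$ denotes the induced invertible $A_{(h,\tilde h)}$-linear map of $A_{(h,\tilde h)}\otimes U$ (substitute the matrix of $C$, with entries in $A_{(h,\tilde h)}$, into the rational representation $\rho$). Tensor modules. A tensor module on $\mathbb{S}^2$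 corresponding to a finite-dimensional rational $\mathrm{GL}_2$-module $(U,\rho)$ is an $A\mathcal{V}$-module $M$ which is finitely generated over $A$ and for which there exist injective $A\mathcal{V}$-module homomorphisms $\varphi_h:M\to A_{(h)}\otimes U$ for each $h\in\{x,y,z\}$, such that for every pair $h,\tilde h$ one has $\rho(C)\circ\varphi_h=\varphi_{\tilde h}$ as maps $M\to A_{(h,\tilde h)}\otimes U$ (using $A_{(h)}\otimes U,\ A_{(\tilde h)}\otimes U\subset A_{(h,\tilde h)}\otimes U$).
   Formalization: The tensor module M is assumed to be nonzero: the definition of a tensor module literally admits M = 0, which is not simple under the usual convention that a simple module is nonzero. *)

theory Defs
  imports
    "HOL-Analysis.Analysis"
    "HOL-Computational_Algebra.Polynomial_Factorial"
    "HOL-Computational_Algebra.Formal_Power_Series"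
    "HOL-Library.Poly_Mapping"
begin

section \<open>The coordinate ring of the sphere\<close>

datatype axis = X | Y | Z

text \<open>\<open>'k poly poly poly\<close> is read as \<open>k[x][y][z]\<close>.\<close>

fun poly_var :: "axis \<Rightarrow> 'k::comm_ring_1 poly poly poly" where
  "poly_var X = [:[:[:0, 1:]:]:]"
| "poly_var Y = [:[:0, 1:]:]"
| "poly_var Z = [:0, 1:]"

definition sphere_poly :: "'k::comm_ring_1 poly poly poly" where
  "sphere_poly = poly_var X ^ 2 + poly_var Y ^ 2 + poly_var Z ^ 2 - 1"

quotient_type (overloaded) 'k sphere = "'k::field_char_0 poly poly poly" /
  "\<lambda>p q. sphere_poly dvd (p - q)"
proof (rule equivpI)
  show "reflp (\<lambda>p q :: 'k poly poly poly. sphere_poly dvd (p - q))"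
    by (auto simp: reflp_def)
  show "symp (\<lambda>p q :: 'k poly poly poly. sphere_poly dvd (p - q))"
    by (metis dvd_minus_iff minus_diff_eq sympI)
  show "transp (\<lambda>p q :: 'k poly poly poly. sphere_poly dvd (p - q))"
  proof (rule transpI)
    fix p q r :: "'k poly poly poly"
    assume "sphere_poly dvd (p - q)" "sphere_poly dvd (q - r)"
    then have "sphere_poly dvd ((p - q) + (q - r))" by (rule dvd_add)
    then show "sphere_poly dvd (p - r)" by simp
  qed
qed

instantiation sphere :: (field_char_0) comm_ring_1
begin

lift_definition zero_sphere :: "'a sphere" is 0 .
lift_definition one_sphere :: "'a sphere" is 1 .

lift_definition plus_sphere :: "'a sphere \<Rightarrow> 'a sphere \<Rightarrow> 'a sphere" is "(+)"
proof -
  fix p q r s :: "'a poly poly poly"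
  assume "sphere_poly dvd (p - q)" "sphere_poly dvd (r - s)"
  then have "sphere_poly dvd ((p - q) + (r - s))" by (rule dvd_add)
  then show "sphere_poly dvd (p + r - (q + s))" by (simp add: algebra_simps)
qed

lift_definition uminus_sphere :: "'a sphere \<Rightarrow> 'a sphere" is uminus
  by (metis dvd_minus_iff minus_diff_minus)

lift_definition minus_sphere :: "'a sphere \<Rightarrow> 'a sphere \<Rightarrow> 'a sphere" is "(-)"
proof -
  fix p q r s :: "'a poly poly poly"
  assume "sphere_poly dvd (p - q)" "sphere_poly dvd (r - s)"
  then have "sphere_poly dvd ((p - q) - (r - s))" by (rule dvd_diff)
  then show "sphere_poly dvd (p - r - (q - s))" by (simp add: algebra_simps)
qed

lift_definition times_sphere :: "'a sphere \<Rightarrow> 'a sphere \<Rightarrow> 'a sphere" is "(*)"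
proof -
  fix p q r s :: "'a poly poly poly"
  assume "sphere_poly dvd (p - q)" "sphere_poly dvd (r - s)"
  then have "sphere_poly dvd ((p - q) * r + q * (r - s))" by simp
  then show "sphere_poly dvd (p * r - q * s)" by (simp add: algebra_simps)
qed

instance
proof
  show "(0 :: 'a sphere) \<noteq> 1"
  proof transfer
    have "degree (sphere_poly :: 'a poly poly poly) = 2"
      by (simp add: sphere_poly_def power2_eq_square one_pCons)
    then have "\<not> sphere_poly dvd (1 :: 'a poly poly poly)"
      by (auto dest!: dvd_imp_degree_le)
    then show "\<not> sphere_poly dvd (0 - (1 :: 'a poly poly poly))" by simp
  qed
qed (transfer; simp add: algebra_simps)+

end

lift_definition coord :: "axis \<Rightarrow> 'k::field_char_0 sphere" is poly_var .

lift_definition const :: "'k::field_char_0 \<Rightarrow> 'k sphere" is "\<lambda>c. [:[:[:c:]:]:]" .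

lemma sphere_poly_altdef:
  "sphere_poly = [:[:[:-1, 0, 1:], 0, 1:], 0, (1 :: 'k::comm_ring_1 poly poly):]"
  by (simp add: sphere_poly_def power2_eq_square one_pCons)

text \<open>
  The coordinate ring is a domain: modulo \<open>sphere_poly\<close> every element is \<open>a + b z\<close>, with norm
  \<open>a\<^sup>2 + (x\<^sup>2 + y\<^sup>2 - 1) b\<^sup>2\<close>, and this norm is anisotropic over \<open>k[x][y]\<close>.
\<close>

lemma sphere_norm_aux:
  fixes a b :: "'k::field_char_0 poly"
  assumes "a ^ 2 + [:-1, 0, 1:] * b ^ 2 = 0"
  shows "a = 0 \<and> b = 0"
proof -
  have b: "b = 0"
  proof (rule ccontr)
    assume "b \<noteq> 0"
    have eq: "a ^ 2 = [:1, -1:] * [:1, 1:] * b ^ 2"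
    proof -
      have "[:-1, 0, 1:] = - ([:1, -1:] * [:1, 1 :: 'k:])" by simp
      with assms show ?thesis by (simp only: mult_minus_left add_eq_0_iff2 minus_minus)
    qed
    have "[:1, -1 :: 'k:] * [:1, 1:] * b ^ 2 \<noteq> 0"
      using \<open>b \<noteq> 0\<close> by (intro no_zero_divisors) auto
    then have "a \<noteq> 0" unfolding eq[symmetric] by simp
    have o1: "order 1 [:1, -1 :: 'k:] = 1"
    proof -
      have "[:1, -1 :: 'k:] = smult (-1) ([:-1, 1:] ^ 1)" by simp
      then show ?thesis by (metis neg_equal_0_iff_equal one_neq_zero order_power_n_n order_smult)
    qed
    have o2: "order 1 [:1, 1 :: 'k:] = 0"
      by (rule order_0I) simp
    define u where "u = [:1, -1 :: 'k:] * [:1, 1:]"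
    have "u \<noteq> 0" unfolding u_def by (intro no_zero_divisors) auto
    then have "order 1 u = 1"
      using order_mult[of "[:1, -1 :: 'k:]" "[:1, 1:]" 1] o1 o2 unfolding u_def by simp
    moreover have "order 1 (u * (b * b)) = order 1 u + (order 1 b + order 1 b)"
      using \<open>b \<noteq> 0\<close> \<open>u \<noteq> 0\<close> by (simp add: order_mult)
    moreover have "order 1 (a * a) = order 1 a + order 1 a"
      using \<open>a \<noteq> 0\<close> by (simp add: order_mult)
    moreover have "a * a = u * (b * b)"
      using eq unfolding u_def power2_eq_square .
    ultimately have "2 * order 1 a = 1 + 2 * order 1 b" by simp
    then show False by presburger
  qed
  with assms show ?thesis by simp
qed

lemma sphere_norm_eq_0:
  fixes a b :: "'k::field_char_0 poly poly"
  assumes "a ^ 2 + [:[:-1, 0, 1:], 0, 1:] * b ^ 2 = 0"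
  shows "a = 0 \<and> b = 0"
  using assms
proof (induction "degree b" arbitrary: a b rule: less_induct)
  case less
  have "poly (a ^ 2 + [:[:-1, 0, 1:], 0, 1:] * b ^ 2) 0 = 0"
    unfolding less.prems by simp
  then have "poly a 0 ^ 2 + [:-1, 0, 1:] * poly b 0 ^ 2 = 0" by simp
  then have "poly a 0 = 0 \<and> poly b 0 = 0" by (rule sphere_norm_aux)
  then have "[:0, 1:] dvd a" "[:0, 1:] dvd b"
    using poly_eq_0_iff_dvd[of a 0] poly_eq_0_iff_dvd[of b 0] by auto
  then obtain a' b' where ab: "a = [:0, 1:] * a'" "b = [:0, 1:] * b'" by (auto elim!: dvdE)
  show ?case
  proof (cases "b = 0")
    case True
    with less.prems show ?thesis by simp
  next
    case False
    then have "b' \<noteq> 0" using ab by auto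
    then have "degree b' < degree b" by (simp add: ab)
    have "[:0, 1:] ^ 2 * (a' ^ 2 + [:[:-1, 0, 1:], 0, 1:] * b' ^ 2) = 0"
      using less.prems unfolding ab power_mult_distrib
      by (simp only: distrib_left mult.left_commute)
    moreover have "[:0, 1 :: 'k poly:] ^ 2 \<noteq> 0" by (intro power_not_zero) simp
    ultimately have "a' ^ 2 + [:[:-1, 0, 1:], 0, 1:] * b' ^ 2 = 0"
      by (metis mult_eq_0_iff)
    from less.hyps[OF \<open>degree b' < degree b\<close> this] show ?thesis using ab by (metis mult_zero_right)
  qed
qed

lemma sphere_poly_representative:
  fixes p :: "'k::field_char_0 poly poly poly"
  shows "\<exists>a b. sphere_poly dvd (p - [:a, b:])"
proof (induction p)
  case 0
  show ?case by (rule exI[of _ 0], rule exI[of _ 0]) simp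
next
  case (pCons c p)
  then obtain a b where ab: "sphere_poly dvd (p - [:a, b:])" by blast
  define s where "s = [:[:-1, 0, 1 :: 'k:], 0, 1:]"
  have "pCons c p - [:c - b * s, a:] = [:0, 1:] * (p - [:a, b:]) + [:b:] * [:s, 0, 1:]"
    by (rule poly_eqI) (simp add: coeff_pCons split: nat.split)
  moreover have "sphere_poly dvd [:0, 1:] * (p - [:a, b:]) + [:b:] * [:s, 0, 1:]"
    using dvd_add[OF dvd_mult[OF ab] dvd_mult[OF dvd_refl]]
    unfolding sphere_poly_altdef s_def .
  ultimately show ?case by metis
qed

lemma sphere_poly_no_zero_divisors:
  fixes p q :: "'k::field_char_0 poly poly poly"
  assumes "sphere_poly dvd p * q"
  shows "sphere_poly dvd p \<or> sphere_poly dvd q"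
proof -
  define s where "s = [:[:-1, 0, 1 :: 'k:], 0, 1:]"
  obtain a b where p: "sphere_poly dvd (p - [:a, b:])" using sphere_poly_representative by blast
  obtain c d where q: "sphere_poly dvd (q - [:c, d:])" using sphere_poly_representative by blast
  have sp: "sphere_poly = [:s, 0, 1:]" by (simp add: sphere_poly_altdef s_def)
  have prod_diff: "p * q - ((p - u) * q + u * (q - v)) = u * v" for u v :: "'k poly poly poly"
    by (simp add: algebra_simps)
  have "p * q - ((p - [:a, b:]) * q + [:a, b:] * (q - [:c, d:])) = [:a, b:] * [:c, d:]"
    by (rule prod_diff)
  moreover have "[:a, b:] * [:c, d:] - [:b * d:] * sphere_poly = [:a * c - s * (b * d), a * d + b * c:]"
    by (simp add: sp mult.commute[of b c])
  ultimately have "p * q - ((p - [:a, b:]) * q + [:a, b:] * (q - [:c, d:])) - [:b * d:] * sphere_poly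
      = [:a * c - s * (b * d), a * d + b * c:]"
    by simp
  moreover have "sphere_poly dvd p * q - ((p - [:a, b:]) * q + [:a, b:] * (q - [:c, d:])) - [:b * d:] * sphere_poly"
    by (intro dvd_diff dvd_add assms dvd_mult2[OF p] dvd_mult[OF q] dvd_mult[OF dvd_refl])
  ultimately have *: "sphere_poly dvd [:a * c - s * (b * d), a * d + b * c:]" by simp
  have "[:a * c - s * (b * d), a * d + b * c:] = 0"
  proof (rule ccontr)
    assume "[:a * c - s * (b * d), a * d + b * c:] \<noteq> 0"
    from dvd_imp_degree_le[OF * this] show False
      by (simp add: sphere_poly_altdef split: if_splits)
  qed
  then have e1: "a * c - s * (b * d) = 0" and e2: "a * d + b * c = 0" by simp_all
  have norm_mult: "(a ^ 2 + s * b ^ 2) * (c ^ 2 + s * d ^ 2) = (a * c - s * (b * d)) ^ 2 + s * (a * d + b * c) ^ 2"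
    for a b c d s :: "'k poly poly"
    by (simp add: power2_eq_square algebra_simps)
  have "(a ^ 2 + s * b ^ 2) * (c ^ 2 + s * d ^ 2) = (a * c - s * (b * d)) ^ 2 + s * (a * d + b * c) ^ 2"
    by (rule norm_mult)
  then have "a ^ 2 + s * b ^ 2 = 0 \<or> c ^ 2 + s * d ^ 2 = 0" using e1 e2 by simp
  then have "a = 0 \<and> b = 0 \<or> c = 0 \<and> d = 0"
    unfolding s_def using sphere_norm_eq_0 by blast
  then show ?thesis using p q by (metis diff_zero pCons_0_0)
qed

instance sphere :: (field_char_0) idom
proof
  fix a b :: "'a sphere"
  assume "a \<noteq> 0" "b \<noteq> 0"
  then show "a * b \<noteq> 0"
    by transfer (use sphere_poly_no_zero_divisors in auto)
qed

section \<open>Charts, vector fields and modules over them\<close>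

text \<open>
  The rings \<open>A\<^sub>(\<^sub>h\<^sub>)\<close> and \<open>A\<^sub>(\<^sub>h\<^sub>,\<^sub>h\<^sub>'\<^sub>)\<close> are realised inside the fraction field of the domain \<open>A\<close>, so that all
  the inclusions between them are literal.
\<close>

definition localization :: "'a::idom \<Rightarrow> 'a fract set" where
  "localization s = {to_fract a / to_fract s ^ n | a n. True}"

definition chart_ring :: "axis \<Rightarrow> 'k::field_char_0 sphere fract set" where
  "chart_ring h = localization (coord h)"

definition fconst :: "'k::field_char_0 \<Rightarrow> 'k sphere fract" where
  "fconst c = to_fract (const c)"

text \<open>
  \<open>derivations \<iota> S\<close>: derivations of the subring \<open>S\<close>, linear over the field embedded by \<open>\<iota>\<close>,
  extended by \<open>0\<close> outside \<open>S\<close> so that they are determined by their values on \<open>S\<close>.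
\<close>

definition derivations :: "('k \<Rightarrow> 'r::comm_ring_1) \<Rightarrow> 'r set \<Rightarrow> ('r \<Rightarrow> 'r) set" where
  "derivations \<iota> S = {D.
     (\<forall>a\<in>S. D a \<in> S) \<and> (\<forall>a. a \<notin> S \<longrightarrow> D a = 0) \<and>
     (\<forall>a\<in>S. \<forall>b\<in>S. D (a + b) = D a + D b) \<and>
     (\<forall>c. \<forall>a\<in>S. D (\<iota> c * a) = \<iota> c * D a) \<and>
     (\<forall>a\<in>S. \<forall>b\<in>S. D (a * b) = D a * b + a * D b)}"

definition vector_fields :: "('k::field_char_0 sphere \<Rightarrow> 'k sphere) set" where
  "vector_fields = derivations const UNIV"

definition lie_bracket :: "('r::ab_group_add \<Rightarrow> 'r) \<Rightarrow> ('r \<Rightarrow> 'r) \<Rightarrow> 'r \<Rightarrow> 'r" where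
  "lie_bracket \<eta> \<mu> = (\<lambda>a. \<eta> (\<mu> a) - \<mu> (\<eta> a))"

text \<open>The vector space structure of a module is the one induced by \<open>const\<close>.\<close>

locale AV_module = module scaleM
  for scaleM :: "'k::field_char_0 sphere \<Rightarrow> 'm::ab_group_add \<Rightarrow> 'm" +
  fixes act :: "('k sphere \<Rightarrow> 'k sphere) \<Rightarrow> 'm \<Rightarrow> 'm"
  assumes act_add_right: "\<eta> \<in> vector_fields \<Longrightarrow> act \<eta> (m + n) = act \<eta> m + act \<eta> n"
    and act_scale_right:
      "\<eta> \<in> vector_fields \<Longrightarrow> act \<eta> (scaleM (const c) m) = scaleM (const c) (act \<eta> m)"
    and act_add_left:
      "\<eta> \<in> vector_fields \<Longrightarrow> \<mu> \<in> vector_fields \<Longrightarrow> act (\<lambda>a. \<eta> a + \<mu> a) m = act \<eta> m + act \<mu> m"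
    and act_scale_left:
      "\<eta> \<in> vector_fields \<Longrightarrow> act (\<lambda>a. const c * \<eta> a) m = scaleM (const c) (act \<eta> m)"
    and act_bracket:
      "\<eta> \<in> vector_fields \<Longrightarrow> \<mu> \<in> vector_fields \<Longrightarrow>
        act (lie_bracket \<eta> \<mu>) m = act \<eta> (act \<mu> m) - act \<mu> (act \<eta> m)"
    and act_Leibniz:
      "\<eta> \<in> vector_fields \<Longrightarrow> act \<eta> (scaleM a m) = scaleM (\<eta> a) m + scaleM a (act \<eta> m)"
begin

definition submodule :: "'m set \<Rightarrow> bool" where
  "submodule N \<longleftrightarrow> subspace N \<and> (\<forall>\<eta>\<in>vector_fields. \<forall>m\<in>N. act \<eta> m \<in> N)"

definition simple :: bool where
  "simple \<longleftrightarrow> (\<exists>m::'m. m \<noteq> 0) \<and> (\<forall>N. submodule N \<longrightarrow> N = {0} \<or> N = UNIV)"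

end

text \<open>Parameters \<open>t\<^sub>1, t\<^sub>2\<close> are indexed by the type \<^typ>\<open>2\<close>, whose elements are \<open>1\<close> and \<open>2 = 0\<close>.\<close>

fun chart_axis :: "axis \<Rightarrow> 2 \<Rightarrow> axis" where
  "chart_axis X i = (if i = 1 then Y else Z)"
| "chart_axis Y i = (if i = 1 then X else Z)"
| "chart_axis Z i = (if i = 1 then X else Y)"

definition chart_param :: "axis \<Rightarrow> 2 \<Rightarrow> 'k::field_char_0 sphere" where
  "chart_param h i = coord (chart_axis h i)"

definition chart_deriv :: "axis \<Rightarrow> 2 \<Rightarrow> 'k::field_char_0 sphere fract \<Rightarrow> 'k sphere fract" where
  "chart_deriv h i = (THE D. D \<in> derivations fconst (chart_ring h) \<and>
     (\<forall>j. D (to_fract (chart_param h j)) = (if j = i then 1 else 0)))"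

text \<open>
  Existence in \<open>chart_deriv\<close>: \<open>h \<partial>/\<partial>t\<^sub>i\<close> is the restriction of the rotation field
  \<open>h \<partial>\<^sub>i - t\<^sub>i \<partial>\<^sub>h\<close> of affine space, which kills \<open>sphere_poly\<close>.
\<close>

definition is_deriv :: "('r::comm_ring_1 \<Rightarrow> 'r) \<Rightarrow> bool" where
  "is_deriv d \<longleftrightarrow> (\<forall>a b. d (a + b) = d a + d b) \<and> (\<forall>a b. d (a * b) = d a * b + a * d b)"

lemma is_deriv_0: "is_deriv d \<Longrightarrow> d 0 = 0"
  unfolding is_deriv_def by (metis add_cancel_right_right)

lemma is_deriv_add: "is_deriv d \<Longrightarrow> d (a + b) = d a + d b"
  and is_deriv_mult: "is_deriv d \<Longrightarrow> d (a * b) = d a * b + a * d b"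
  by (simp_all add: is_deriv_def)

lemma is_deriv_diff: "is_deriv d \<Longrightarrow> d (a - b) = d a - d b"
  unfolding is_deriv_def by (metis add_diff_cancel diff_add_cancel)

lemma is_deriv_sum: "is_deriv d \<Longrightarrow> d (sum f S) = (\<Sum>x\<in>S. d (f x))"
  by (induction S rule: infinite_finite_induct) (simp_all add: is_deriv_0, simp add: is_deriv_def)

lemma is_deriv_pderiv: "is_deriv (pderiv :: 'r::idom poly \<Rightarrow> 'r poly)"
  by (simp add: is_deriv_def pderiv_add pderiv_mult algebra_simps)

lemma is_deriv_map_poly:
  assumes d: "is_deriv d"
  shows "is_deriv (map_poly d)"
  unfolding is_deriv_def
proof (intro conjI allI)
  note [simp] = coeff_map_poly[of d, OF is_deriv_0[OF d]]
  fix p q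
  show "map_poly d (p + q) = map_poly d p + map_poly d q"
    using d by (intro poly_eqI) (simp add: is_deriv_def)
  show "map_poly d (p * q) = map_poly d p * q + p * map_poly d q"
    using d by (intro poly_eqI)
      (simp add: coeff_mult is_deriv_sum sum.distrib[symmetric], simp add: is_deriv_def)
qed

fun pd :: "axis \<Rightarrow> 'k::field_char_0 poly poly poly \<Rightarrow> 'k poly poly poly" where
  "pd X = map_poly (map_poly pderiv)"
| "pd Y = map_poly pderiv"
| "pd Z = pderiv"

lemma is_deriv_pd: "is_deriv (pd a)"
  by (cases a) (simp_all add: is_deriv_pderiv is_deriv_map_poly)

lemma pd_var: "pd a (poly_var b) = (if a = b then 1 else 0)"
  by (cases a; cases b) (simp_all add: map_poly_pCons pderiv_pCons one_pCons)

lemma pd_const: "pd a [:[:[:c:]:]:] = 0"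
  by (cases a) (simp_all add: map_poly_pCons pderiv_pCons)

definition rot_poly :: "axis \<Rightarrow> axis \<Rightarrow> 'k::field_char_0 poly poly poly \<Rightarrow> 'k poly poly poly" where
  "rot_poly a b p = poly_var a * pd b p - poly_var b * pd a p"

lemma is_deriv_rot_poly: "is_deriv (rot_poly a b)"
  unfolding is_deriv_def rot_poly_def is_deriv_add[OF is_deriv_pd] is_deriv_mult[OF is_deriv_pd]
  by (simp add: algebra_simps)

lemma rot_poly_sphere_poly: "rot_poly a b sphere_poly = 0"
proof -
  note d = is_deriv_rot_poly[of a b]
  have one: "rot_poly a b 1 = 0"
    using is_deriv_mult[OF d, of 1 1] by simp
  have v: "rot_poly a b (poly_var c) = (if b = c then poly_var a else 0) - (if a = c then poly_var b else 0)" for c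
    by (simp add: rot_poly_def pd_var)
  have "rot_poly a b sphere_poly = 2 * (poly_var X * rot_poly a b (poly_var X) +
      poly_var Y * rot_poly a b (poly_var Y) + poly_var Z * rot_poly a b (poly_var Z))"
    unfolding sphere_poly_def power2_eq_square is_deriv_diff[OF d] is_deriv_add[OF d] is_deriv_mult[OF d] one
    by (simp only: mult_2 diff_zero distrib_left ac_simps)
  also have "poly_var X * rot_poly a b (poly_var X) + poly_var Y * rot_poly a b (poly_var Y) +
      poly_var Z * rot_poly a b (poly_var Z) = 0"
    unfolding v by (cases a; cases b) (simp_all del: poly_var.simps)
  finally show ?thesis by simp
qed

lift_definition rot :: "axis \<Rightarrow> axis \<Rightarrow> 'k::field_char_0 sphere \<Rightarrow> 'k sphere" is rot_poly
proof -
  fix a b and p q :: "'k poly poly poly"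
  assume "sphere_poly dvd (p - q)"
  then obtain r where "p - q = sphere_poly * r" by (auto elim: dvdE)
  then have "rot_poly a b (p - q) = sphere_poly * rot_poly a b r"
    by (simp only: is_deriv_mult[OF is_deriv_rot_poly] rot_poly_sphere_poly mult_zero_left add_0)
  then show "sphere_poly dvd (rot_poly a b p - rot_poly a b q)"
    by (simp add: is_deriv_diff[OF is_deriv_rot_poly])
qed

lemma is_deriv_rot: "is_deriv (rot a b)"
  unfolding is_deriv_def
proof (intro conjI allI)
  fix f g :: "'a sphere"
  show "rot a b (f + g) = rot a b f + rot a b g"
    by transfer (simp only: is_deriv_add[OF is_deriv_rot_poly] diff_self dvd_0_right)
  show "rot a b (f * g) = rot a b f * g + f * rot a b g"
    by transfer (simp only: is_deriv_mult[OF is_deriv_rot_poly] diff_self dvd_0_right)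
qed

lemma rot_coord: "rot a b (coord c) = (if b = c then coord a else 0) - (if a = c then coord b else 0)"
  by transfer (simp add: rot_poly_def pd_var)

lemma rot_const: "rot a b (const c) = 0"
  by transfer (simp add: rot_poly_def pd_const)

lemma quotient_rule_add:
  fixes A B A' B' p q p' q' :: "'a::field"
  assumes "B \<noteq> 0" "B' \<noteq> 0"
  shows "((p * B' + A * q' + (p' * B + A' * q)) * (B * B') - (A * B' + A' * B) * (q * B' + B * q')) / (B * B')\<^sup>2
    = (p * B - A * q) / B\<^sup>2 + (p' * B' - A' * q') / B'\<^sup>2"
proof -
  have "(p * B' + A * q' + (p' * B + A' * q)) * (B * B') - (A * B' + A' * B) * (q * B' + B * q')
      = (p * B - A * q) * B'\<^sup>2 + (p' * B' - A' * q') * B\<^sup>2"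
    by (simp add: algebra_simps power2_eq_square)
  with assms show ?thesis by (simp add: add_frac_eq power_mult_distrib)
qed

lemma quotient_rule_mult:
  fixes A B A' B' p q p' q' :: "'a::field"
  assumes "B \<noteq> 0" "B' \<noteq> 0"
  shows "((p * A' + A * p') * (B * B') - A * A' * (q * B' + B * q')) / (B * B')\<^sup>2
    = (p * B - A * q) / B\<^sup>2 * (A' / B') + A / B * ((p' * B' - A' * q') / B'\<^sup>2)"
proof -
  have "(p * A' + A * p') * (B * B') - A * A' * (q * B' + B * q')
      = (p * B - A * q) * (A' * B') + (A * B) * (p' * B' - A' * q')"
    by (simp add: algebra_simps)
  with assms show ?thesis by (simp add: add_divide_distrib power_mult_distrib power2_eq_square ac_simps)
qed

lemma is_deriv_fract:
  fixes d :: "'a::idom \<Rightarrow> 'a"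
  assumes d: "is_deriv d"
  shows "\<exists>D. is_deriv D \<and> (\<forall>a. D (to_fract a) = to_fract (d a))"
proof -
  define D where "D = (\<lambda>x. THE y. \<forall>a b. b \<noteq> 0 \<and> x = to_fract a / to_fract b \<longrightarrow>
    y * to_fract b ^ 2 = to_fract (d a) * to_fract b - to_fract a * to_fract (d b))"
  have dm: "d (a * b) = d a * b + a * d b" and da: "d (a + b) = d a + d b" for a b
    using d by (simp_all add: is_deriv_def)
  have D: "D (to_fract a / to_fract b) = (to_fract (d a) * to_fract b - to_fract a * to_fract (d b)) / to_fract b ^ 2"
    if b: "b \<noteq> 0" for a b
    unfolding D_def
  proof (rule the_equality, intro allI impI, elim conjE)
    fix a' b' assume b': "b' \<noteq> 0" and "to_fract a / to_fract b = to_fract a' / to_fract b'"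
    then have "to_fract (a * b') = to_fract (a' * b)"
      using b by (simp add: divide_simps split: if_splits)
    then have eq: "a * b' = a' * b" by (simp only: to_fract_eq_iff)
    then have "d (a * b') = d (a' * b)" by simp
    then have "d a * b' + a * d b' = d a' * b + a' * d b" by (simp add: dm)
    with eq have "(d a * b - a * d b) * b' ^ 2 = (d a' * b' - a' * d b') * b ^ 2"
      by algebra
    then have "to_fract ((d a * b - a * d b) * b' ^ 2) = to_fract ((d a' * b' - a' * d b') * b ^ 2)" by simp
    then show "(to_fract (d a) * to_fract b - to_fract a * to_fract (d b)) / to_fract b ^ 2 * to_fract b' ^ 2
      = to_fract (d a') * to_fract b' - to_fract a' * to_fract (d b')"
      using b by (simp add: divide_eq_eq power2_eq_square)
  next
    fix y
    assume "\<forall>a' b'. b' \<noteq> 0 \<and> to_fract a / to_fract b = to_fract a' / to_fract b' \<longrightarrow>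
      y * to_fract b' ^ 2 = to_fract (d a') * to_fract b' - to_fract a' * to_fract (d b')"
    with b have "y * to_fract b ^ 2 = to_fract (d a) * to_fract b - to_fract a * to_fract (d b)" by blast
    then show "y = (to_fract (d a) * to_fract b - to_fract a * to_fract (d b)) / to_fract b ^ 2"
      using b by (simp add: eq_divide_eq)
  qed
  have repr: "\<exists>a b. b \<noteq> 0 \<and> x = to_fract a / to_fract b" for x :: "'a fract"
    by (cases x) (metis Fract_conv_to_fract)
  have d1: "d 1 = 0" using dm[of 1 1] by (metis add_cancel_right_right mult.right_neutral mult_1)
  have "is_deriv D"
    unfolding is_deriv_def
  proof (intro conjI allI)
    fix x y :: "'a fract"
    obtain a b where b: "b \<noteq> 0" and x: "x = to_fract a / to_fract b" using repr by blast
    obtain a' b' where b': "b' \<noteq> 0" and y: "y = to_fract a' / to_fract b'" using repr by blast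
    have bb: "b * b' \<noteq> 0" using b b' by simp
    have "x + y = to_fract (a * b' + a' * b) / to_fract (b * b')"
      using b b' by (simp add: x y add_frac_eq)
    then have *: "D (x + y) = (to_fract (d (a * b' + a' * b)) * to_fract (b * b') -
        to_fract (a * b' + a' * b) * to_fract (d (b * b'))) / to_fract (b * b') ^ 2"
      by (simp only: D[OF bb])
    show "D (x + y) = D x + D y"
      unfolding * unfolding x y D[OF b] D[OF b'] dm da to_fract_add to_fract_mult
      by (rule quotient_rule_add) (use b b' in simp_all)
    have "x * y = to_fract (a * a') / to_fract (b * b')" by (simp add: x y)
    then have *: "D (x * y) = (to_fract (d (a * a')) * to_fract (b * b') -
        to_fract (a * a') * to_fract (d (b * b'))) / to_fract (b * b') ^ 2"
      by (simp only: D[OF bb])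
    show "D (x * y) = D x * y + x * D y"
      unfolding * unfolding x y D[OF b] D[OF b'] dm da to_fract_add to_fract_mult
      by (rule quotient_rule_mult) (use b b' in simp_all)
  qed
  moreover have "D (to_fract a) = to_fract (d a)" for a
    using D[of 1 a] d1 is_deriv_0[OF d] by simp
  ultimately show ?thesis by blast
qed

lemma coord_nonzero: "coord a \<noteq> (0 :: 'k::field_char_0 sphere)"
proof
  assume "coord a = (0 :: 'k sphere)"
  then have *: "sphere_poly dvd (poly_var a :: 'k poly poly poly)" by transfer simp
  have "poly_var a \<noteq> (0 :: 'k poly poly poly)" by (cases a) simp_all
  from dvd_imp_degree_le[OF * this] show False by (cases a) (simp_all add: sphere_poly_altdef)
qed

lemma sphere_relation: "coord X ^ 2 + coord Y ^ 2 + coord Z ^ 2 = (1 :: 'k::field_char_0 sphere)"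
  unfolding power2_eq_square by transfer (simp add: sphere_poly_def power2_eq_square)

lemma sphere_induct [case_names const coord add mult]:
  fixes f :: "'k::field_char_0 sphere"
  assumes const: "\<And>c. P (const c)" and coord: "\<And>a. P (coord a)"
    and add: "\<And>f g. P f \<Longrightarrow> P g \<Longrightarrow> P (f + g)"
    and mult: "\<And>f g. P f \<Longrightarrow> P g \<Longrightarrow> P (f * g)"
  shows "P f"
proof -
  have abs_add: "abs_sphere (p + q) = abs_sphere p + abs_sphere q"
    and abs_mult: "abs_sphere (p * q) = abs_sphere p * abs_sphere q"
    for p q :: "'k poly poly poly"
    by (simp_all add: plus_sphere.abs_eq times_sphere.abs_eq)
  have split: "[:[:pCons c r:]:] = [:[:[:c:]:]:] + poly_var X * [:[:r:]:]"
    "[:pCons r p:] = [:[:r:]:] + poly_var Y * [:p:]"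
    "pCons p q = [:p:] + poly_var Z * q"
    for c :: 'k and r :: "'k poly" and p :: "'k poly poly" and q :: "'k poly poly poly"
    by simp_all
  have c: "P (abs_sphere [:[:[:c:]:]:])" for c
    using const[of c] by (simp add: const.abs_eq)
  have v: "P (abs_sphere (poly_var a))" for a
    using coord[of a] by (simp add: coord.abs_eq)
  have 1: "P (abs_sphere [:[:r:]:])" for r
  proof (induction r)
    case 0
    show ?case using c[of 0] by simp
  next
    case (pCons a r)
    then show ?case unfolding split(1)[of a r] abs_add abs_mult by (intro add mult c v)
  qed
  have 2: "P (abs_sphere [:p:])" for p
  proof (induction p)
    case 0
    show ?case using c[of 0] by simp
  next
    case (pCons r p)
    then show ?case unfolding split(2)[of r p] abs_add abs_mult by (intro add mult 1 v)
  qed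
  have 3: "P (abs_sphere q)" for q
  proof (induction q)
    case 0
    show ?case using c[of 0] by simp
  next
    case (pCons p q)
    then show ?case unfolding split(3)[of p q] abs_add abs_mult by (intro add mult 2 v)
  qed
  show ?thesis using 3[of "rep_sphere f"] Quotient_abs_rep[OF Quotient_sphere] by metis
qed

lemma chart_ringI: "to_fract a / to_fract (coord h) ^ n \<in> chart_ring h"
  by (auto simp: chart_ring_def localization_def)

lemma to_fract_in_chart_ring: "to_fract a \<in> chart_ring h"
  using chart_ringI[of a h 0] by simp

lemma chart_ringE:
  assumes "g \<in> chart_ring h"
  obtains a n where "g * to_fract (coord h) ^ n = to_fract a"
proof -
  obtain a n where "g = to_fract a / to_fract (coord h) ^ n"
    using assms by (auto simp: chart_ring_def localization_def)
  then have "g * to_fract (coord h) ^ n = to_fract a" by (simp add: coord_nonzero)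
  then show thesis by (rule that)
qed

lemma to_fract_power: "to_fract (a ^ n) = to_fract a ^ n"
  by (induction n) simp_all

lemma chart_ring_closed:
  assumes "f \<in> chart_ring h" "g \<in> chart_ring h"
  shows "f + g \<in> chart_ring h" "f * g \<in> chart_ring h"
proof -
  obtain a m where f: "f = to_fract a / to_fract (coord h) ^ m"
    using assms(1) by (auto simp: chart_ring_def localization_def)
  obtain b n where g: "g = to_fract b / to_fract (coord h) ^ n"
    using assms(2) by (auto simp: chart_ring_def localization_def)
  have "f + g = to_fract (a * coord h ^ n + b * coord h ^ m) / to_fract (coord h) ^ (m + n)"
    by (simp add: f g add_frac_eq coord_nonzero to_fract_power power_add)
  then show "f + g \<in> chart_ring h" by (simp only: chart_ringI)
  have "f * g = to_fract (a * b) / to_fract (coord h) ^ (m + n)"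
    by (simp add: f g power_add)
  then show "f * g \<in> chart_ring h" by (simp only: chart_ringI)
qed

lemma chart_axis_neq [simp]: "chart_axis h i \<noteq> h" "h \<noteq> chart_axis h i"
  by (cases h; simp)+

lemma chart_axis_eq_iff [simp]: "chart_axis h i = chart_axis h j \<longleftrightarrow> i = j"
  using exhaust_2[of i] exhaust_2[of j] by (cases h) auto

lemma axis_cases_chart: "a = h \<or> (\<exists>i. a = chart_axis h i)"
proof (cases "a = h")
  case False
  then have "a = chart_axis h 1 \<or> a = chart_axis h 2" by (cases a; cases h) simp_all
  then show ?thesis by blast
qed simp

lemma extend_derivation:
  fixes \<delta> :: "'k::field_char_0 sphere \<Rightarrow> 'k sphere"
  assumes \<delta>: "is_deriv \<delta>" "\<And>c. \<delta> (const c) = 0"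
  shows "\<exists>D\<in>derivations fconst (chart_ring h). \<forall>a. D (to_fract a) = to_fract (\<delta> a)"
proof -
  obtain E :: "'k sphere fract \<Rightarrow> 'k sphere fract" where E: "is_deriv E"
    and ext: "\<And>a. E (to_fract a) = to_fract (\<delta> a)"
    using is_deriv_fract[OF \<delta>(1)] by blast
  let ?h = "to_fract (coord h) :: 'k sphere fract"
  define D where "D = (\<lambda>g. if g \<in> chart_ring h then E g else 0)"
  have closed: "E g \<in> chart_ring h" if "g \<in> chart_ring h" for g
  proof -
    obtain a n where a: "g * ?h ^ n = to_fract a" using \<open>g \<in> chart_ring h\<close> by (rule chart_ringE)
    let ?b = "\<delta> (coord h ^ n)" and ?c = "\<delta> a"
    have "E (g * ?h ^ n) = E g * ?h ^ n + g * to_fract ?b"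
      using ext[of "coord h ^ n"] by (simp add: is_deriv_mult[OF E] to_fract_power)
    then have "E g * ?h ^ n = to_fract ?c - g * to_fract ?b"
      by (simp add: a ext)
    then have "(E g * ?h ^ n) * ?h ^ n = (to_fract ?c - g * to_fract ?b) * ?h ^ n"
      by (rule arg_cong)
    also have "\<dots> = to_fract ?c * ?h ^ n - (g * ?h ^ n) * to_fract ?b"
      by (simp add: algebra_simps)
    finally have "E g * ?h ^ (n + n) = to_fract (?c * coord h ^ n - a * ?b)"
      by (simp add: a power_add to_fract_power mult.assoc)
    then have "E g = to_fract (?c * coord h ^ n - a * ?b) / ?h ^ (n + n)"
      by (simp add: eq_divide_eq coord_nonzero)
    then show ?thesis by (simp only: chart_ringI)
  qed
  have "E (fconst c) = 0" for c by (simp add: fconst_def ext \<delta>(2))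
  moreover have "fconst c \<in> chart_ring h" for c :: 'k
    by (simp add: fconst_def to_fract_in_chart_ring)
  ultimately have "D \<in> derivations fconst (chart_ring h)"
    by (auto simp: derivations_def D_def closed chart_ring_closed is_deriv_add[OF E] is_deriv_mult[OF E])
  moreover have "D (to_fract a) = to_fract (\<delta> a)" for a
    by (simp add: D_def to_fract_in_chart_ring ext)
  ultimately show ?thesis by blast
qed

lemma derivations_scale:
  assumes D: "D \<in> derivations \<iota> S" and r: "r \<in> S"
    and mult: "\<And>a b. a \<in> S \<Longrightarrow> b \<in> S \<Longrightarrow> a * b \<in> S"
  shows "(\<lambda>g. r * D g) \<in> derivations \<iota> S"
  unfolding derivations_def
proof (rule CollectI, intro conjI ballI allI impI)
  fix a b c assume a: "a \<in> S" and b: "b \<in> S"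
  show "r * D a \<in> S" using D r a by (auto simp: derivations_def intro: mult)
  have "D (a + b) = D a + D b" "D (\<iota> c * a) = \<iota> c * D a" "D (a * b) = D a * b + a * D b"
    using D a b unfolding derivations_def by blast+
  then show "r * D (a + b) = r * D a + r * D b" "r * D (\<iota> c * a) = \<iota> c * (r * D a)"
    "r * D (a * b) = r * D a * b + a * (r * D b)"
    by (simp_all add: distrib_left mult.left_commute mult.assoc)
qed (use D in \<open>simp add: derivations_def\<close>)

lemma chart_deriv_exists:
  "\<exists>D. D \<in> derivations fconst (chart_ring h) \<and>
     (\<forall>j. D (to_fract (chart_param h j)) = (if j = i then 1 else (0 :: 'k::field_char_0 sphere fract)))"
proof -
  let ?r = "inverse (to_fract (coord h)) :: 'k sphere fract"
  have r: "?r \<in> chart_ring h"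
    using chart_ringI[of 1 h 1] by (simp add: divide_inverse)
  obtain E :: "'k sphere fract \<Rightarrow> 'k sphere fract" where E: "E \<in> derivations fconst (chart_ring h)"
    and ext: "\<And>a. E (to_fract a) = to_fract (rot h (chart_axis h i) a)"
    using extend_derivation[of "rot h (chart_axis h i)" h, OF is_deriv_rot rot_const] by blast
  have "(\<lambda>g. ?r * E g) \<in> derivations fconst (chart_ring h)"
    by (rule derivations_scale[OF E r chart_ring_closed(2)])
  moreover have "?r * E (to_fract (chart_param h j)) = (if j = i then 1 else 0)" for j
    unfolding ext chart_param_def rot_coord by (simp add: coord_nonzero)
  ultimately show ?thesis by (intro exI[of _ "\<lambda>g. ?r * E g"] conjI allI)
qed

lemma chart_derivation_eq_0:
  fixes D :: "'k::field_char_0 sphere fract \<Rightarrow> 'k sphere fract"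
  assumes add: "\<And>f g. f \<in> chart_ring h \<Longrightarrow> g \<in> chart_ring h \<Longrightarrow> D (f + g) = D f + D g"
    and mult: "\<And>f g. f \<in> chart_ring h \<Longrightarrow> g \<in> chart_ring h \<Longrightarrow> D (f * g) = D f * g + f * D g"
    and const: "\<And>c f. f \<in> chart_ring h \<Longrightarrow> D (fconst c * f) = fconst c * D f"
    and param: "\<And>i. D (to_fract (chart_param h i)) = 0"
    and g: "g \<in> chart_ring h"
  shows "D g = 0"
proof -
  note [simp] = to_fract_in_chart_ring
  have one: "D 1 = 0"
    using mult[of 1 1] to_fract_in_chart_ring[of 1 h]
    by (metis add_cancel_right_right mult.right_neutral mult_1 to_fract_1)
  have c: "D (fconst c) = 0" for c
    using const[of 1 c] one to_fract_in_chart_ring[of 1 h] by simp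
  have add': "D (to_fract f + to_fract g) = D (to_fract f) + D (to_fract g)"
    and mult': "D (to_fract f * to_fract g) = D (to_fract f) * to_fract g + to_fract f * D (to_fract g)"
    for f g
    by (simp_all add: add mult)
  have other: "D (to_fract (coord (chart_axis h i))) = 0" for i
    using param[of i] by (simp add: chart_param_def)
  have "D (to_fract (coord X * coord X + coord Y * coord Y + coord Z * coord Z)) = 0"
    using sphere_relation one unfolding power2_eq_square by (metis to_fract_1)
  then have "(\<Sum>a\<in>{X, Y, Z}. 2 * (to_fract (coord a) * D (to_fract (coord a)))) = 0"
    using add'[of "coord X * coord X + coord Y * coord Y" "coord Z * coord Z"]
      add'[of "coord X * coord X" "coord Y * coord Y"]
      mult'[of "coord X" "coord X"] mult'[of "coord Y" "coord Y"] mult'[of "coord Z" "coord Z"]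
    by (simp add: ac_simps)
  moreover have "{X, Y, Z} = UNIV" using axis.exhaust by auto
  moreover have "(\<Sum>a\<in>UNIV. 2 * (to_fract (coord a) * D (to_fract (coord a))))
      = 2 * (to_fract (coord h) * D (to_fract (coord h)))"
  proof (rule sum.remove[of UNIV h, THEN trans])
    show "finite (UNIV :: axis set)" using \<open>{X, Y, Z} = UNIV\<close> by (metis finite.simps)
    have "D (to_fract (coord a)) = 0" if "a \<noteq> h" for a
      using axis_cases_chart[of a h] other that by auto
    then show "2 * (to_fract (coord h) * D (to_fract (coord h))) +
      (\<Sum>a\<in>UNIV - {h}. 2 * (to_fract (coord a) * D (to_fract (coord a))))
      = 2 * (to_fract (coord h) * D (to_fract (coord h)))"
      by simp
  qed simp
  ultimately have "2 * (to_fract (coord h) * D (to_fract (coord h))) = 0"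
    by metis
  moreover have "(2 :: 'k sphere fract) \<noteq> 0"
  proof
    assume "(2 :: 'k sphere fract) = 0"
    then have "to_fract (2 :: 'k sphere) = 0"
      by (metis one_add_one to_fract_1 to_fract_add)
    then have "(2 :: 'k sphere) = 0" by simp
    moreover have "(1 :: 'k sphere) + 1 = const 2"
      by transfer (simp add: one_pCons)
    ultimately have "const (2 :: 'k) = 0" by (simp only: one_add_one)
    then have *: "sphere_poly dvd [:[:[:2 :: 'k:]:]:]" by transfer simp
    show False using dvd_imp_degree_le[OF *] by (simp add: sphere_poly_altdef)
  qed
  ultimately have h: "D (to_fract (coord h)) = 0" by (simp add: coord_nonzero)
  have A: "D (to_fract f) = 0" for f
  proof (induction f rule: sphere_induct)
    case (const k)
    then show ?case using c[of k] by (simp add: fconst_def)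
  next
    case (coord a)
    then show ?case using axis_cases_chart[of a h] h other by auto
  next
    case (add f g)
    then show ?case using add'[of f g] by simp
  next
    case (mult f g)
    then show ?case using mult'[of f g] by simp
  qed
  obtain a n where a: "g * to_fract (coord h) ^ n = to_fract a" using g by (rule chart_ringE)
  then have "D (g * to_fract (coord h ^ n)) = 0" using A[of a] by (simp add: to_fract_power)
  then show ?thesis
    using mult[OF g to_fract_in_chart_ring, of "coord h ^ n"] A[of "coord h ^ n"]
    by (simp add: to_fract_power coord_nonzero)
qed

lemma chart_deriv_ex1:
  "\<exists>!D. D \<in> derivations fconst (chart_ring h) \<and>
     (\<forall>j. D (to_fract (chart_param h j)) = (if j = i then 1 else (0 :: 'k::field_char_0 sphere fract)))"
proof (rule ex_ex1I[OF chart_deriv_exists], elim conjE)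
  fix D E
  assume D: "D \<in> derivations fconst (chart_ring h)" and E: "E \<in> derivations fconst (chart_ring h)"
    and pD: "\<forall>j. D (to_fract (chart_param h j)) = (if j = i then 1 else (0 :: 'k sphere fract))"
    and pE: "\<forall>j. E (to_fract (chart_param h j)) = (if j = i then 1 else (0 :: 'k sphere fract))"
  show "D = E"
  proof
    fix g
    show "D g = E g"
    proof (cases "g \<in> chart_ring h")
      case True
      have "D g - E g = 0"
        by (rule chart_derivation_eq_0[of h "\<lambda>g. D g - E g", OF _ _ _ _ True])
          (use D E pD pE in \<open>simp_all add: derivations_def algebra_simps\<close>)
      then show ?thesis by simp
    qed (use D E in \<open>simp add: derivations_def\<close>)
  qed
qed

lemma
  shows chart_deriv_in_derivations: "chart_deriv h i \<in> derivations fconst (chart_ring h)"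
    and chart_deriv_param: "chart_deriv h i (to_fract (chart_param h j)) = (if j = i then 1 else 0)"
  using theI'[OF chart_deriv_ex1[of h i]] unfolding chart_deriv_def by blast+

text \<open>
  A vector field \<open>\<eta>\<close>, extended to the chart ring, is \<open>\<Sum>\<^sub>i f\<^sub>i \<partial>/\<partial>t\<^sub>i\<close> with \<open>f\<^sub>i = \<eta> t\<^sub>i\<close>.
\<close>

definition chart_coeff :: "axis \<Rightarrow> ('k::field_char_0 sphere \<Rightarrow> 'k sphere) \<Rightarrow> 2 \<Rightarrow> 'k sphere fract" where
  "chart_coeff h \<eta> i = to_fract (\<eta> (chart_param h i))"

lemma derivationsD:
  assumes "D \<in> derivations \<iota> S" "f \<in> S"
  shows "g \<in> S \<Longrightarrow> D (f + g) = D f + D g"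
    and "g \<in> S \<Longrightarrow> D (f * g) = D f * g + f * D g"
    and "D (\<iota> c * f) = \<iota> c * D f"
  using assms unfolding derivations_def by blast+

lemma vector_field_extension_eq:
  assumes \<eta>: "\<eta> \<in> vector_fields"
    and D: "D \<in> derivations fconst (chart_ring h)" "\<And>a. D (to_fract a) = to_fract (\<eta> a)"
    and g: "g \<in> chart_ring h"
  shows "D g = (\<Sum>i\<in>UNIV. chart_coeff h \<eta> i * chart_deriv h i g)"
proof -
  note der = derivationsD[OF D(1)] derivationsD[OF chart_deriv_in_derivations]
  have "D g - (\<Sum>i\<in>UNIV. chart_coeff h \<eta> i * chart_deriv h i g) = 0"
  proof (rule chart_derivation_eq_0[of h, OF _ _ _ _ g])
    fix j
    show "D (to_fract (chart_param h j)) -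
        (\<Sum>i\<in>UNIV. chart_coeff h \<eta> i * chart_deriv h i (to_fract (chart_param h j))) = 0"
      by (simp add: chart_deriv_param D(2) chart_coeff_def if_distrib sum.delta sum.delta' cong: if_cong)
  qed (simp_all add: der UNIV_2, simp_all add: algebra_simps)
  then show ?thesis by simp
qed

lemma vector_field_extension_exists:
  assumes \<eta>: "\<eta> \<in> vector_fields"
  shows "\<exists>D\<in>derivations fconst (chart_ring h). \<forall>a. D (to_fract a) = to_fract (\<eta> a)"
proof (rule extend_derivation)
  show d: "is_deriv \<eta>" using \<eta> by (simp add: vector_fields_def derivations_def is_deriv_def)
  have "\<eta> 1 = 0"
    using is_deriv_mult[OF d, of 1 1] by (metis add_cancel_right_right mult.right_neutral mult_1)
  moreover have "\<eta> (const c * 1) = const c * \<eta> 1" for c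
    using \<eta> unfolding vector_fields_def derivations_def by blast
  ultimately show "\<eta> (const c) = 0" for c by (metis mult.right_neutral mult_zero_right)
qed


section \<open>Rational representations and tensor modules\<close>

text \<open>
  Polynomials in the entries of a \<open>2 \<times> 2\<close> matrix, evaluated at a matrix over an algebra whose
  structure map is \<open>\<iota>\<close>.
\<close>

type_synonym 'k matrix_poly = "((2 \<times> 2, nat) poly_mapping, 'k) poly_mapping"

definition eval_matrix_poly ::
    "('k::zero \<Rightarrow> 'r::comm_ring_1) \<Rightarrow> 'k matrix_poly \<Rightarrow> 'r^2^2 \<Rightarrow> 'r" where
  "eval_matrix_poly \<iota> P A =
     (\<Sum>m\<in>Poly_Mapping.keys P. \<iota> (Poly_Mapping.lookup P m) *
       (\<Prod>(i, j)\<in>UNIV. (A $ i $ j) ^ Poly_Mapping.lookup m (i, j)))"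

text \<open>
  A regular function on \<open>GL\<^sub>2\<close> is one of the form \<open>P / det\<^sup>n\<close>. Since \<open>GL\<^sub>2(k)\<close> is dense,
  the value of \<open>GL2_subst\<close> does not depend on the chosen representation \<open>(P, n)\<close>, as long as
  \<open>det A\<close> is a unit whose inverse is given by \<open>inverse\<close>.
\<close>

definition represents_on_GL2 ::
    "'k matrix_poly \<Rightarrow> nat \<Rightarrow> ('k::field^2^2 \<Rightarrow> 'k) \<Rightarrow> bool" where
  "represents_on_GL2 P n f \<longleftrightarrow>
     (\<forall>g. invertible g \<longrightarrow> f g = eval_matrix_poly (\<lambda>c. c) P g / det g ^ n)"

definition regular_on_GL2 :: "('k::field^2^2 \<Rightarrow> 'k) \<Rightarrow> bool" where
  "regular_on_GL2 f \<longleftrightarrow> (\<exists>P n. represents_on_GL2 P n f)"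

definition GL2_subst ::
    "('k::field \<Rightarrow> 'r::{comm_ring_1, inverse}) \<Rightarrow> ('k^2^2 \<Rightarrow> 'k) \<Rightarrow> 'r^2^2 \<Rightarrow> 'r" where
  "GL2_subst \<iota> f A =
     (let (P, n) = (SOME (P, n). represents_on_GL2 P n f)
      in eval_matrix_poly \<iota> P A * inverse (det A) ^ n)"

definition matrix_unit :: "2 \<Rightarrow> 2 \<Rightarrow> 'k::zero_neq_one^2^2" where
  "matrix_unit p i = (\<chi> q j. if q = p \<and> j = i then 1 else 0)"

definition change_of_charts :: "axis \<Rightarrow> axis \<Rightarrow> 'k::field_char_0 sphere fract^2^2" where
  "change_of_charts h h' = (\<chi> j i. chart_deriv h' j (to_fract (chart_param h i)))"

text \<open>
  \<open>Basis\<close> is an arbitrary basis of \<open>U\<close>; it serves to write \<open>F \<otimes> U\<close> (with \<open>F\<close> the fraction field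
  of \<open>A\<close>) as the space of functions \<open>Basis \<Rightarrow> F\<close>, extended by \<open>0\<close> to the whole type.
\<close>

locale rational_GL2_module = finite_dimensional_vector_space scaleU Basis
  for scaleU :: "'k::field_char_0 \<Rightarrow> 'u::ab_group_add \<Rightarrow> 'u" and Basis :: "'u set" +
  fixes \<rho> :: "'k^2^2 \<Rightarrow> 'u \<Rightarrow> 'u"
  assumes rho_linear: "invertible g \<Longrightarrow> Vector_Spaces.linear scaleU scaleU (\<rho> g)"
    and rho_one: "\<rho> (mat 1) u = u"
    and rho_mult: "invertible g \<Longrightarrow> invertible g' \<Longrightarrow> \<rho> (g ** g') u = \<rho> g (\<rho> g' u)"
    and rho_rational:
      "b \<in> Basis \<Longrightarrow> b' \<in> Basis \<Longrightarrow> regular_on_GL2 (\<lambda>g. representation Basis (\<rho> g b) b')"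
begin

definition simple :: bool where
  "simple \<longleftrightarrow> (\<exists>u::'u. u \<noteq> 0) \<and>
     (\<forall>W. subspace W \<and> (\<forall>g. invertible g \<longrightarrow> (\<forall>w\<in>W. \<rho> g w \<in> W)) \<longrightarrow> W = {0} \<or> W = UNIV)"

definition matrix_coeff :: "'u \<Rightarrow> 'u \<Rightarrow> 'k^2^2 \<Rightarrow> 'k" where
  "matrix_coeff b' b g = representation Basis (\<rho> g b) b'"

text \<open>The action of \<open>E \<in> gl\<^sub>2\<close>: the derivative of \<open>\<rho>(1 + t E)\<close> at \<open>t = 0\<close>.\<close>

definition gl_act :: "'k^2^2 \<Rightarrow> 'u \<Rightarrow> 'u" where
  "gl_act E u = (\<Sum>b\<in>Basis. \<Sum>b'\<in>Basis.
     scaleU (representation Basis u b *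
       fps_nth (fps_deriv (GL2_subst fps_const (matrix_coeff b' b)
         (mat 1 + (\<chi> p q. fps_X * fps_const (E $ p $ q))))) 0) b')"

definition tensor_space :: "axis \<Rightarrow> ('u \<Rightarrow> 'k sphere fract) set" where
  "tensor_space h = {t. (\<forall>b\<in>Basis. t b \<in> chart_ring h) \<and> (\<forall>b. b \<notin> Basis \<longrightarrow> t b = 0)}"

definition pure_tensor :: "'k sphere fract \<Rightarrow> 'u \<Rightarrow> 'u \<Rightarrow> 'k sphere fract" where
  "pure_tensor g u = (\<lambda>c. g * fconst (representation Basis u c))"

definition pure_act ::
    "axis \<Rightarrow> ('k sphere \<Rightarrow> 'k sphere) \<Rightarrow> 'k sphere fract \<Rightarrow> 'u \<Rightarrow> 'u \<Rightarrow> 'k sphere fract" where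
  "pure_act h \<eta> g u = (\<lambda>c.
     (\<Sum>i\<in>UNIV. pure_tensor (chart_coeff h \<eta> i * chart_deriv h i g) u c) +
     (\<Sum>p\<in>UNIV. \<Sum>i\<in>UNIV.
        pure_tensor (g * chart_deriv h p (chart_coeff h \<eta> i)) (gl_act (matrix_unit p i) u) c))"

text \<open>The additive extension of \<open>pure_act\<close>, by \<open>t = (\<Sum>b\<in>Basis. pure_tensor (t b) b)\<close>.\<close>

definition tensor_act ::
    "axis \<Rightarrow> ('k sphere \<Rightarrow> 'k sphere) \<Rightarrow> ('u \<Rightarrow> 'k sphere fract) \<Rightarrow> 'u \<Rightarrow> 'k sphere fract" where
  "tensor_act h \<eta> t = (\<lambda>c. \<Sum>b\<in>Basis. pure_act h \<eta> (t b) b c)"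

lemma representation_sum_Basis:
  assumes "Vector_Spaces.linear scaleU scaleU L"
  shows "(\<Sum>b\<in>Basis. representation Basis u b * representation Basis (L b) c) = representation Basis (L u) c"
proof -
  interpret L: Vector_Spaces.linear scaleU scaleU L by fact
  have "L u = L (\<Sum>b\<in>Basis. scaleU (representation Basis u b) b)"
    using sum_representation_eq[OF independent_Basis _ finite_Basis order_refl] span_Basis by simp
  also have "\<dots> = (\<Sum>b\<in>Basis. scaleU (representation Basis u b) (L b))"
    by (simp add: L.sum L.scale)
  finally have "representation Basis (L u) =
      representation Basis (\<Sum>b\<in>Basis. scaleU (representation Basis u b) (L b))" by simp
  then show ?thesis
    using independent_Basis span_Basis
    by (simp add: representation_sum representation_scale)
qed

lemma linear_gl_act: "Vector_Spaces.linear scaleU scaleU (gl_act E)"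
proof unfold_locales
  note [simp] = gl_act_def representation_add representation_scale independent_Basis span_Basis
  show "gl_act E (u + v) = gl_act E u + gl_act E v" for u v
    by (simp add: scale_left_distrib distrib_right sum.distrib)
  show "gl_act E (scaleU c u) = scaleU c (gl_act E u)" for c u
    by (simp add: scale_sum_right mult.assoc)
qed

lemma tensor_act_pure_tensor:
  assumes "g \<in> chart_ring h"
  shows "tensor_act h \<eta> (pure_tensor g u) = pure_act h \<eta> g u"
proof
  fix c
  let ?r = "representation Basis"
  have const_hom: "const (a + b) = const a + const b" "const (a * b) = const a * const b"
    "const (0 :: 'k) = 0" for a b :: 'k
    by (transfer; simp)+
  have hom: "fconst (a * b) = fconst a * fconst b" for a b :: 'k
    by (simp add: fconst_def const_hom)
  have hom_sum: "fconst (sum f S) = (\<Sum>x\<in>S. fconst (f x))" for f :: "'u \<Rightarrow> 'k" and S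
  proof (induction S rule: infinite_finite_induct)
    case (insert x F)
    then show ?case by (simp add: fconst_def const_hom(1))
  qed (simp_all add: fconst_def const_hom(3))
  have cd: "chart_deriv h i (g * fconst k) = chart_deriv h i g * fconst k" for i k
    using derivationsD(3)[OF chart_deriv_in_derivations assms] by (simp add: mult.commute)
  have *: "(\<Sum>b\<in>Basis. y * fconst (?r u b) * fconst (?r (L b) c)) = y * fconst (?r (L u) c)"
    if "Vector_Spaces.linear scaleU scaleU L" for y L
  proof -
    have "y * fconst (?r u b) * fconst (?r (L b) c) = y * fconst (?r u b * ?r (L b) c)" for b
      by (simp only: hom mult.assoc)
    then show ?thesis
      by (simp only: sum_distrib_left[symmetric] hom_sum[symmetric] representation_sum_Basis[OF that])
  qed
  have "(\<Sum>b\<in>Basis. (\<Sum>i\<in>UNIV. y i * fconst (?r u b) * fconst (?r b c)) +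
      (\<Sum>p\<in>UNIV. \<Sum>i\<in>UNIV. z p i * fconst (?r u b) * fconst (?r (gl_act (matrix_unit p i) b) c)))
    = (\<Sum>i\<in>UNIV. y i * fconst (?r u c)) +
      (\<Sum>p\<in>UNIV. \<Sum>i\<in>UNIV. z p i * fconst (?r (gl_act (matrix_unit p i) u) c))"
    for y :: "2 \<Rightarrow> 'k sphere fract" and z :: "2 \<Rightarrow> 2 \<Rightarrow> 'k sphere fract"
  proof -
    have "(\<Sum>b\<in>Basis. \<Sum>p\<in>UNIV. \<Sum>i\<in>UNIV. w b p i) = (\<Sum>p\<in>UNIV. \<Sum>i\<in>UNIV. \<Sum>b\<in>Basis. w b p i)"
      for w :: "'u \<Rightarrow> 2 \<Rightarrow> 2 \<Rightarrow> 'k sphere fract"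
      by (subst sum.swap, intro sum.cong refl, rule sum.swap)
    moreover have "(\<Sum>b\<in>Basis. \<Sum>i\<in>UNIV. w b i) = (\<Sum>i\<in>UNIV. \<Sum>b\<in>Basis. w b i)"
      for w :: "'u \<Rightarrow> 2 \<Rightarrow> 'k sphere fract"
      by (rule sum.swap)
    ultimately show ?thesis
      by (simp only: sum.distrib *[OF linear_gl_act] *[OF linear_ident])
  qed
  moreover have "chart_coeff h \<eta> i * (d * fconst r) * e = chart_coeff h \<eta> i * d * fconst r * e"
    "g * fconst r * d * e = g * d * fconst r * e" for i d r e
    by (simp_all add: mult_ac)
  ultimately show "tensor_act h \<eta> (pure_tensor g u) c = pure_act h \<eta> g u c"
    unfolding tensor_act_def pure_act_def pure_tensor_def cd by (simp only:)
qed

definition rho_subst ::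
    "'k sphere fract^2^2 \<Rightarrow> ('u \<Rightarrow> 'k sphere fract) \<Rightarrow> 'u \<Rightarrow> 'k sphere fract" where
  "rho_subst C t = (\<lambda>b'. if b' \<in> Basis then
     \<Sum>b\<in>Basis. GL2_subst fconst (matrix_coeff b' b) C * t b else 0)"

definition chart_hom ::
    "('k sphere \<Rightarrow> 'm::ab_group_add \<Rightarrow> 'm) \<Rightarrow> (('k sphere \<Rightarrow> 'k sphere) \<Rightarrow> 'm \<Rightarrow> 'm) \<Rightarrow>
     axis \<Rightarrow> ('m \<Rightarrow> 'u \<Rightarrow> 'k sphere fract) \<Rightarrow> bool" where
  "chart_hom scaleM act h \<phi> \<longleftrightarrow>
     (\<forall>m. \<phi> m \<in> tensor_space h) \<and>
     (\<forall>m n. \<phi> (m + n) = (\<lambda>b. \<phi> m b + \<phi> n b)) \<and>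
     (\<forall>a m. \<phi> (scaleM a m) = (\<lambda>b. to_fract a * \<phi> m b)) \<and>
     (\<forall>\<eta>\<in>vector_fields. \<forall>m. \<phi> (act \<eta> m) = tensor_act h \<eta> (\<phi> m))"

text \<open>The zero module satisfies this definition; nonvanishing has to be assumed separately.\<close>

definition tensor_module ::
    "('k sphere \<Rightarrow> 'm::ab_group_add \<Rightarrow> 'm) \<Rightarrow> (('k sphere \<Rightarrow> 'k sphere) \<Rightarrow> 'm \<Rightarrow> 'm) \<Rightarrow> bool" where
  "tensor_module scaleM act \<longleftrightarrow>
     AV_module scaleM act \<and>
     (\<exists>S. finite S \<and> module.span scaleM S = UNIV) \<and>
     (\<exists>\<phi>. (\<forall>h. inj (\<phi> h) \<and> chart_hom scaleM act h (\<phi> h)) \<and>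
          (\<forall>h h' m. rho_subst (change_of_charts h h') (\<phi> h m) = \<phi> h' m))"

end

end

(*
  For a nonzero submodule N of M, the set {a. a M <= N} is an ideal of A which is stable under all
  vector fields by the Leibniz rule, and A has no proper nonzero ideal stable under the rotation
  fields. So it suffices to find one nonzero a with a M <= N, and for this a single chart h is enough.

  If eta is the field h d/dt_j, the operator act (t_q eta) - t_q act eta is h (1 (x) E_qj) on the
  chart. Hence N is stable under suitable multiples h^n (1 (x) T) for every T in the associative
  algebra generated by gl_2 in End U. In characteristic zero a gl_2-stable subspace is GL_2-stable,
  so gl_2 acts irreducibly, and by Burnside's theorem the algebra contains an operator of rank one.
  Applied to a nonzero element of N it yields some nonzero g with g (x) U inside N; clearing
  denominators on the finitely many generators of M gives a.
*)

theory Submission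
  imports Defs
begin

section \<open>Ideals stable under the rotation fields\<close>

definition plane_emb :: "'k::field_char_0 poly poly \<Rightarrow> 'k sphere" where
  "plane_emb q = abs_sphere [:q:]"

text \<open>The norm down to k[x,y]: since z^2 = -s, multiplying a + b z by its conjugate a - b z
  gives a^2 + s b^2, which is nonzero because this form is anisotropic.\<close>

lemma exists_plane_multiple:
  fixes f :: "'k::field_char_0 sphere"
  assumes "f \<noteq> 0"
  shows "\<exists>q g. q \<noteq> 0 \<and> plane_emb q = f * g"
proof -
  obtain a b where ab: "sphere_poly dvd (rep_sphere f - [:a, b:])"
    using sphere_poly_representative by blast
  have f: "f = abs_sphere [:a, b:]"
    using ab by (metis Quotient_rel_abs Quotient_sphere sphere.abs_eq_iff Quotient_abs_rep)
  define s where "s = [:[:-1, 0, 1 :: 'k:], 0, 1:]"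
  have "a ^ 2 + s * b ^ 2 \<noteq> 0"
  proof
    assume "a ^ 2 + s * b ^ 2 = 0"
    then have "a = 0 \<and> b = 0" unfolding s_def by (rule sphere_norm_eq_0)
    with f assms show False by (simp add: zero_sphere_def)
  qed
  moreover have "plane_emb (a ^ 2 + s * b ^ 2) = f * abs_sphere [:a, -b:]"
  proof -
    have "[:a ^ 2 + s * b ^ 2:] - [:a, b:] * [:a, -b:] = [:b^2:] * [:s, 0, 1:]"
      by (simp add: power2_eq_square mult.commute)
    then have "sphere_poly dvd [:a ^ 2 + s * b ^ 2:] - [:a, b:] * [:a, -b:]"
      unfolding sphere_poly_altdef s_def by (metis dvd_triv_right)
    then show ?thesis
      by (simp only: plane_emb_def f times_sphere.abs_eq sphere.abs_eq_iff)
  qed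
  ultimately show ?thesis by blast
qed

text \<open>On polynomials in x and y the term with the z-derivative vanishes, so only z times a
  partial derivative remains.\<close>

lemma rot_plane_emb:
  "rot Z X (plane_emb q) = coord Z * plane_emb (map_poly pderiv q)"
  "rot Z Y (plane_emb q) = coord Z * plane_emb (pderiv q)"
  by (simp_all add: plane_emb_def rot.abs_eq coord.abs_eq times_sphere.abs_eq rot_poly_def
      map_poly_pCons pderiv_pCons is_deriv_0[OF is_deriv_map_poly[OF is_deriv_pderiv]])

lemma const_add: "const (a + b) = const a + const b"
  and const_zero: "const 0 = 0"
  and const_mult: "const a * const b = const (a * b)"
  and const_one: "const 1 = 1"
  by (transfer; simp add: one_pCons)+

text \<open>A nonzero element has a nonzero multiple in k[x,y]. Differentiating that down to a
  nonzero constant costs powers of z, so some z^n lies in J; rotating z towards x and y and using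
  the sphere relation then lowers n to 0.\<close>

lemma rot_stable_ideal_contains_one:
  fixes J :: "'k::field_char_0 sphere set"
  assumes add: "\<And>f g. f \<in> J \<Longrightarrow> g \<in> J \<Longrightarrow> f + g \<in> J"
    and mult: "\<And>f g. f \<in> J \<Longrightarrow> g * f \<in> J"
    and rot: "\<And>a b f. f \<in> J \<Longrightarrow> rot a b f \<in> J"
    and f: "f \<in> J" "f \<noteq> 0"
  shows "1 \<in> J"
proof -
  let ?z = "coord Z :: 'k sphere"
  have uminus: "- f \<in> J" if "f \<in> J" for f
    using mult[OF that, of "-1"] by simp
  have diff: "f - g \<in> J" if "f \<in> J" "g \<in> J" for f g
    using add[OF that(1) uminus[OF that(2)]] by simp
  \<comment> \<open>One factor z arises because the rotation sends q to z q'. The other makes the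
    unwanted term z rot(z^n) q a multiple of z^n q, hence an element of J.\<close>
  have deriv_step: "?z ^ Suc (Suc n) * q' \<in> J"
    if n: "?z ^ n * q \<in> J" and q: "rot Z a q = ?z * q'" for n q q' a
  proof -
    have r: "rot Z a (?z ^ n * q) = rot Z a (?z ^ n) * q + ?z ^ n * (?z * q')"
      by (simp only: is_deriv_mult[OF is_deriv_rot] q)
    have rz: "\<exists>v. ?z * rot Z a (?z ^ n) = v * ?z ^ n"
    proof (induction n)
      case 0
      have "rot Z a (1 :: 'k sphere) = 0"
        using rot_const[of Z a 1] by (simp add: const_one)
      then show ?case by (intro exI[of _ 0]) simp
    next
      case (Suc n)
      then obtain v where v: "?z * rot Z a (?z ^ n) = v * ?z ^ n" by blast
      have "?z * rot Z a (?z ^ Suc n) = ?z * rot Z a ?z * ?z ^ n + ?z * (?z * rot Z a (?z ^ n))"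
        by (simp add: is_deriv_mult[OF is_deriv_rot] algebra_simps)
      also have "\<dots> = (rot Z a ?z + v) * ?z ^ Suc n"
        unfolding v by (simp add: algebra_simps)
      finally show ?case by blast
    qed
    then obtain v where v: "?z * rot Z a (?z ^ n) = v * ?z ^ n" by blast
    have "?z * rot Z a (?z ^ n * q) - v * (?z ^ n * q) \<in> J"
      by (intro diff mult rot n)
    also have "?z * rot Z a (?z ^ n * q) = v * (?z ^ n * q) + ?z ^ Suc (Suc n) * q'"
      unfolding r distrib_left by (simp add: v mult.assoc[symmetric])
    finally show ?thesis by simp
  qed
  \<comment> \<open>Polynomials in x alone: rotate towards x until only a constant is left.\<close>
  have line: "\<exists>n. ?z ^ n \<in> J" if "r \<noteq> 0" "?z ^ n * plane_emb [:r:] \<in> J" for r n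
    using that
  proof (induction "degree r" arbitrary: r n rule: less_induct)
    case less
    show ?case
    proof (cases "degree r = 0")
      case True
      then obtain c where c: "r = [:c:]" by (elim degree_eq_zeroE)
      with less.prems have "c \<noteq> 0" by simp
      have "const (1 / c) * (?z ^ n * const c) = ?z ^ n"
        using \<open>c \<noteq> 0\<close> const_mult[of "1 / c" c] by (simp add: const_one ac_simps)
      moreover have "plane_emb [:r:] = const c"
        by (simp add: c plane_emb_def const.abs_eq)
      ultimately show ?thesis using mult[OF less.prems(2), of "const (1 / c)"] by metis
    next
      case False
      then have "pderiv r \<noteq> 0" "degree (pderiv r) < degree r"
        by (simp_all add: pderiv_eq_0_iff degree_pderiv)
      moreover have "?z ^ Suc (Suc n) * plane_emb [:pderiv r:] \<in> J"
        by (rule deriv_step[OF less.prems(2), of X]) (simp add: rot_plane_emb map_poly_pCons)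
      ultimately show ?thesis using less.hyps by blast
    qed
  qed
  \<comment> \<open>Here the degree is the one in y; once it is 0, \<open>line\<close> takes
    over.\<close>
  have plane: "\<exists>n. ?z ^ n \<in> J" if "q \<noteq> 0" "?z ^ n * plane_emb q \<in> J" for q n
    using that
  proof (induction "degree q" arbitrary: q n rule: less_induct)
    case less
    show ?case
    proof (cases "degree q = 0")
      case True
      then obtain r where r: "q = [:r:]" by (elim degree_eq_zeroE)
      with less.prems line show ?thesis by auto
    next
      case False
      then have "pderiv q \<noteq> 0" "degree (pderiv q) < degree q"
        by (simp_all add: pderiv_eq_0_iff degree_pderiv)
      moreover have "?z ^ Suc (Suc n) * plane_emb (pderiv q) \<in> J"
        by (rule deriv_step[OF less.prems(2), of Y]) (simp add: rot_plane_emb)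
      ultimately show ?thesis using less.hyps by blast
    qed
  qed
  obtain q g where q: "q \<noteq> 0" "plane_emb q = f * g"
    using exists_plane_multiple[OF f(2)] by blast
  then have "?z ^ 0 * plane_emb q \<in> J" using mult[OF f(1), of g] by (simp add: mult.commute)
  from plane[OF q(1) this] obtain n where "?z ^ n \<in> J" by blast
  then show ?thesis
  proof (induction n)
    case (Suc n)
    have step: "coord a * ?z ^ n \<in> J" if "a \<noteq> Z" for a
    proof -
      have rp: "rot Z a (?z ^ Suc n) = - (of_nat (Suc n) * (coord a * ?z ^ n))" for n
      proof (induction n)
        case 0
        show ?case using that by (simp add: rot_coord)
      next
        case (Suc n)
        have "rot Z a (?z ^ Suc (Suc n)) = rot Z a (?z * ?z ^ Suc n)" by simp
        also have "\<dots> = - (coord a * ?z ^ Suc n)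
            + ?z * - (of_nat (Suc n) * (coord a * ?z ^ n))"
          unfolding is_deriv_mult[OF is_deriv_rot] Suc.IH using that by (simp add: rot_coord)
        finally show ?case by (simp only:) (simp add: algebra_simps)
      qed
      have on: "of_nat k = const (of_nat k :: 'k)" for k
        by (induction k) (simp_all add: const_zero const_one const_add)
      have "const (- 1 / of_nat (Suc n)) * rot Z a (?z ^ Suc n) \<in> J"
        by (intro mult rot Suc.prems)
      also have "const (- 1 / of_nat (Suc n)) * rot Z a (?z ^ Suc n)
          = - (const (- 1 / of_nat (Suc n)) * const (of_nat (Suc n))) * (coord a * ?z ^ n)"
        by (simp only: rp on mult_minus_left mult_minus_right mult.assoc)
      also have "const (- 1 / of_nat (Suc n)) * const (of_nat (Suc n) :: 'k) = const (-1)"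
        unfolding const_mult by (simp del: of_nat_Suc)
      also have "const (-1 :: 'k) = - 1" by transfer (simp add: one_pCons)
      finally show ?thesis by simp
    qed
    have "coord X * (coord X * ?z ^ n) + coord Y * (coord Y * ?z ^ n) + ?z * (?z ^ Suc n) \<in> J"
      by (intro add mult step Suc.prems) simp_all
    also have "coord X * (coord X * ?z ^ n) + coord Y * (coord Y * ?z ^ n) + ?z * (?z ^ Suc n)
        = (coord X ^ 2 + coord Y ^ 2 + coord Z ^ 2) * ?z ^ n"
      by (simp add: power2_eq_square algebra_simps)
    finally show ?case using Suc.IH by (simp add: sphere_relation)
  qed simp
qed

section \<open>Irreducible sets of operators over an algebraically closed field\<close>

definition poly_apply ::
    "('k::field \<Rightarrow> 'v::ab_group_add \<Rightarrow> 'v) \<Rightarrow> ('v \<Rightarrow> 'v) \<Rightarrow> 'k poly \<Rightarrow> 'v \<Rightarrow> 'v" where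
  "poly_apply s S p v = (\<Sum>i\<le>degree p. s (coeff p i) ((S ^^ i) v))"

context finite_dimensional_vector_space
begin

lemma poly_apply_altdef:
  assumes "degree p \<le> n"
  shows "poly_apply scale S p v = (\<Sum>i\<le>n. scale (coeff p i) ((S ^^ i) v))"
  unfolding poly_apply_def
  by (rule sum.mono_neutral_left) (use assms in \<open>auto simp: coeff_eq_0\<close>)

lemma poly_apply_linear_factor:
  assumes S: "Vector_Spaces.linear scale scale S"
  shows "poly_apply scale S ([:-c, 1:] * p) v = S (poly_apply scale S p v) - scale c (poly_apply scale S p v)"
proof -
  interpret S: Vector_Spaces.linear scale scale S by fact
  let ?n = "degree p"
  have "poly_apply scale S ([:-c, 1:] * p) v = (\<Sum>i\<le>Suc ?n. scale (coeff ([:-c, 1:] * p) i) ((S ^^ i) v))"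
    by (rule poly_apply_altdef) (use degree_mult_le[of "[:-c, 1:]" p] in simp)
  also have "\<dots> = (\<Sum>i\<le>Suc ?n. scale (coeff (pCons 0 p) i) ((S ^^ i) v))
      - (\<Sum>i\<le>Suc ?n. scale c (scale (coeff p i) ((S ^^ i) v)))"
    by (simp add: sum_subtractf[symmetric] scale_left_diff_distrib algebra_simps del: sum.atMost_Suc)
  also have "(\<Sum>i\<le>Suc ?n. scale (coeff (pCons 0 p) i) ((S ^^ i) v))
      = (\<Sum>i\<le>?n. scale (coeff p i) ((S ^^ Suc i) v))"
    by (subst sum.atMost_Suc_shift) (simp del: funpow.simps(2) add: o_def)
  also have "\<dots> = S (poly_apply scale S p v)"
    by (simp add: poly_apply_def S.sum S.scale)
  also have "(\<Sum>i\<le>Suc ?n. scale c (scale (coeff p i) ((S ^^ i) v))) = scale c (poly_apply scale S p v)"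
    by (subst poly_apply_altdef[of p "Suc ?n"]) (simp, simp only: scale_sum_right)
  finally show ?thesis .
qed

lemma exists_annihilating_poly:
  "\<exists>p. p \<noteq> 0 \<and> poly_apply scale S p v = 0"
proof (cases "inj_on (\<lambda>i. (S ^^ i) v) {..dimension}")
  case True
  let ?f = "\<lambda>i. (S ^^ i) v"
  have "card (?f ` {..dimension}) = Suc dimension" using True by (simp add: card_image)
  moreover have "dim (?f ` {..dimension}) \<le> dimension" by (rule dim_subset_UNIV)
  ultimately have "dependent (?f ` {..dimension})"
    using dependent_biggerset_general[of "?f ` {..dimension}"] by simp
  then obtain u where u: "(\<Sum>x\<in>?f ` {..dimension}. scale (u x) x) = 0"
    and nz: "\<exists>x\<in>?f ` {..dimension}. u x \<noteq> 0"
    by (subst (asm) dependent_finite) auto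
  have u': "(\<Sum>i\<le>dimension. scale (u (?f i)) (?f i)) = 0"
    using u by (simp add: sum.reindex[OF True])
  define p where "p = Poly (map (\<lambda>i. u (?f i)) [0..<Suc dimension])"
  have c: "coeff p i = (if i \<le> dimension then u (?f i) else 0)" for i
    by (simp add: p_def nth_default_def del: upt_Suc)
  obtain j where "j \<le> dimension" "u (?f j) \<noteq> 0" using nz by auto
  then have "coeff p j \<noteq> 0" by (simp add: c)
  then have "p \<noteq> 0" by auto
  moreover have "degree p \<le> dimension"
    using c by (intro degree_le) simp
  then have "poly_apply scale S p v = 0"
    using u' by (simp add: poly_apply_altdef c)
  ultimately show ?thesis by blast
next
  case False
  \<comment> \<open>A repetition among the powers would leave fewer than
    \<open>dimension + 1\<close> distinct vectors, but it gives the polynomial X^i - X^j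
    directly.\<close>
  then obtain i j where ij: "(S ^^ i) v = (S ^^ j) v" "i \<noteq> j" unfolding inj_on_def by blast
  let ?p = "monom 1 i - monom (1 :: 'a) j"
  have c: "coeff ?p k = (if k = i then 1 else 0) - (if k = j then 1 else 0)" for k
    by simp
  have "?p \<noteq> 0" using c[of i] ij(2) by (metis coeff_0 diff_zero one_neq_zero)
  moreover have "degree ?p \<le> max i j"
    by (intro degree_diff_le order.trans[OF degree_monom_le]) simp_all
  then have "poly_apply scale S ?p v = 0"
    by (simp add: poly_apply_altdef[of ?p "max i j"] c scale_left_diff_distrib sum_subtractf
        if_distrib[of "\<lambda>c. scale c _"] ij(1) cong: if_cong)
  ultimately show ?thesis by blast
qed

end

text \<open>Take a basis of S through v: the images of the other basis vectors already span
  f(S).\<close>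

lemma (in finite_dimensional_vector_space) dim_image_less:
  assumes f: "Vector_Spaces.linear scale scale f" and S: "subspace S"
    and v: "v \<in> S" "v \<noteq> 0" "f v = 0"
  shows "dim (f ` S) < dim S"
proof -
  interpret f: Vector_Spaces.linear scale scale f by fact
  have "independent {v}" using v by simp
  then obtain B where B: "{v} \<subseteq> B" "B \<subseteq> S" "independent B" "S \<subseteq> span B"
    using maximal_independent_subset_extend[of "{v}" S] v(1) by auto
  have fB: "finite B" using B(3) by (rule finiteI_independent)
  have "f ` S \<subseteq> span (f ` (B - {v}))"
  proof -
    have "f ` S \<subseteq> span (f ` B)" using B(4) f.span_image by blast
    also have "f ` B \<subseteq> insert 0 (f ` (B - {v}))" using v(3) by auto
    then have "span (f ` B) \<subseteq> span (f ` (B - {v}))" by (metis span_insert_0 span_mono)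
    finally show ?thesis .
  qed
  then have "dim (f ` S) \<le> card (f ` (B - {v}))" using fB by (intro dim_le_card) auto
  also have "\<dots> \<le> card (B - {v})" using fB by (intro card_image_le) simp
  also have "\<dots> < card B" using fB B(1) by (intro psubset_card_mono) auto
  also have "card B = dim S" using B by (intro basis_card_eq_dim) auto
  finally show ?thesis .
qed

text \<open>An inductive closure, so that a property of the generators can be carried to every
  operator while a power of h, depending on the operator, accumulates.\<close>

inductive_set generated_algebra :: "('k::field \<Rightarrow> 'v::ab_group_add \<Rightarrow> 'v) \<Rightarrow> ('v \<Rightarrow> 'v) set \<Rightarrow> ('v \<Rightarrow> 'v) set"
  for s :: "'k \<Rightarrow> 'v \<Rightarrow> 'v" and G :: "('v \<Rightarrow> 'v) set" where
  generator: "g \<in> G \<Longrightarrow> g \<in> generated_algebra s G"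
| ident: "(\<lambda>v. v) \<in> generated_algebra s G"
| add: "S \<in> generated_algebra s G \<Longrightarrow> T \<in> generated_algebra s G \<Longrightarrow> (\<lambda>v. S v + T v) \<in> generated_algebra s G"
| scale: "T \<in> generated_algebra s G \<Longrightarrow> (\<lambda>v. s c (T v)) \<in> generated_algebra s G"
| comp: "S \<in> generated_algebra s G \<Longrightarrow> T \<in> generated_algebra s G \<Longrightarrow> (\<lambda>v. S (T v)) \<in> generated_algebra s G"

locale irreducible_operators = finite_dimensional_vector_space scale Basis
  for scale :: "'k::alg_closed_field \<Rightarrow> 'v::ab_group_add \<Rightarrow> 'v" and Basis +
  fixes G :: "('v \<Rightarrow> 'v) set"
  assumes linear_G: "g \<in> G \<Longrightarrow> Vector_Spaces.linear scale scale g"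
    and irreducible: "subspace W \<Longrightarrow> (\<And>g w. g \<in> G \<Longrightarrow> w \<in> W \<Longrightarrow> g w \<in> W) \<Longrightarrow> W = {0} \<or> W = UNIV"
    and nontrivial: "\<exists>v::'v. v \<noteq> 0"
begin

abbreviation "\<A> \<equiv> generated_algebra scale G"

lemma linear_generated:
  "T \<in> \<A> \<Longrightarrow> Vector_Spaces.linear scale scale T"
proof (induction rule: generated_algebra.induct)
  case (generator g)
  then show ?case by (rule linear_G)
next
  case ident
  show ?case by (rule linear_ident)
next
  case (add S T)
  then show ?case by (simp add: Vector_Spaces.linear_iff algebra_simps scale_right_distrib)
next
  case (scale T c)
  then show ?case by (simp add: Vector_Spaces.linear_iff scale_right_distrib mult.commute)
next
  case (comp S T)
  then show ?case by (simp add: Vector_Spaces.linear_iff)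
qed

text \<open>The vectors T v form a G-stable subspace, which contains v through the identity.\<close>

lemma transitive:
  assumes "v \<noteq> 0"
  shows "\<exists>T\<in>\<A>. T v = w"
proof -
  let ?W = "{T v |T. T \<in> \<A>}"
  have "subspace ?W"
    unfolding subspace_def
  proof (intro conjI ballI allI)
    show "0 \<in> ?W"
      using generated_algebra.scale[OF generated_algebra.ident, of scale 0 G] by force
    show "x + y \<in> ?W" if xy: "x \<in> ?W" "y \<in> ?W" for x y
    proof -
      obtain S T where "S \<in> \<A>" "x = S v" "T \<in> \<A>" "y = T v" using xy by auto
      then show ?thesis using generated_algebra.add[of S scale G T] by force
    qed
    show "scale c x \<in> ?W" if x: "x \<in> ?W" for c x
    proof -
      obtain T where "T \<in> \<A>" "x = T v" using x by auto
      then show ?thesis using generated_algebra.scale[of T scale G c] by force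
    qed
  qed
  moreover have "g w \<in> ?W" if g: "g \<in> G" and w: "w \<in> ?W" for g w
  proof -
    obtain T where "T \<in> \<A>" "w = T v" using w by auto
    then show ?thesis
      using generated_algebra.comp[OF generated_algebra.generator[OF g], of T scale] by force
  qed
  moreover have "v \<in> ?W"
    using generated_algebra.ident[of scale G] by force
  ultimately have "?W = UNIV" using irreducible[of ?W] assms by blast
  then have "w \<in> ?W" by simp
  then obtain T where "T \<in> \<A>" "w = T v" unfolding mem_Collect_eq by (elim exE conjE)
  then show ?thesis by (intro bexI[of _ T]) simp_all
qed

text \<open>Take an annihilating polynomial p of v of least degree and split off a root c, p = (X -
  c) q. Minimality makes q(S) v nonzero, and S acts on it by c; being a combination of the S^i v, it
  stays in V.\<close>

lemma eigenvector_in_invariant_subspace: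
  assumes S: "Vector_Spaces.linear scale scale S" and V: "subspace V" "\<And>v. v \<in> V \<Longrightarrow> S v \<in> V"
    and v: "v \<in> V" "v \<noteq> 0"
  shows "\<exists>c w. w \<in> V \<and> w \<noteq> 0 \<and> S w = scale c w"
proof -
  define P where "P = (\<lambda>p. p \<noteq> 0 \<and> poly_apply scale S p v = 0)"
  have "\<exists>p. P p" using exists_annihilating_poly unfolding P_def by blast
  then obtain p where p: "P p" and min: "\<And>q. P q \<Longrightarrow> degree p \<le> degree q"
    using ex_has_least_nat[of P _ degree] by metis
  have "degree p > 0"
  proof (rule ccontr)
    assume "\<not> degree p > 0"
    then have "degree p = 0" by simp
    then obtain c where "p = [:c:]" by (elim degree_eq_zeroE)
    with p v(2) show False by (simp add: P_def poly_apply_def)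
  qed
  then obtain c where "poly p c = 0" using alg_closed_imp_poly_has_root by blast
  then obtain q where q: "p = [:-c, 1:] * q" unfolding poly_eq_0_iff_dvd by (rule dvdE)
  have "q \<noteq> 0" using p q by (auto simp: P_def)
  then have "degree q < degree p" unfolding q by (subst degree_mult_eq) simp_all
  then have "poly_apply scale S q v \<noteq> 0" using min[of q] \<open>q \<noteq> 0\<close> unfolding P_def by fastforce
  moreover have "S (poly_apply scale S q v) = scale c (poly_apply scale S q v)"
    using p unfolding P_def q poly_apply_linear_factor[OF S] by simp
  moreover have "(S ^^ i) v \<in> V" for i by (induction i) (simp_all add: v V(2))
  then have "poly_apply scale S q v \<in> V" unfolding poly_apply_def
    using V(1) by (intro subspace_sum subspace_scale)
  ultimately show ?thesis by blast
qed

text \<open>The Lomonosov--Rosenthal argument for Burnside's theorem.\<close>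

lemma rank_one_in_generated:
  "\<exists>T\<in>\<A>. \<exists>u. u \<noteq> 0 \<and> (\<exists>v. T v \<noteq> 0) \<and> (\<forall>v. \<exists>c. T v = scale c u)"
proof -
  define P where "P = (\<lambda>T. T \<in> \<A> \<and> (\<exists>v. T v \<noteq> 0))"
  have "P (\<lambda>v. v)" using nontrivial by (simp add: P_def generated_algebra.ident)
  then obtain T where T: "P T" and min: "\<And>S. P S \<Longrightarrow> dim (range T) \<le> dim (range S)"
    using ex_has_least_nat[of P _ "\<lambda>T. dim (range T)"] by metis
  have TA: "T \<in> \<A>" using T by (simp add: P_def)
  obtain x where x: "T x \<noteq> 0" using T by (auto simp: P_def)
  interpret T: Vector_Spaces.linear scale scale T by (rule linear_generated[OF TA])
  have "\<exists>c. T y = scale c (T x)" for y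
  proof (rule ccontr)
    assume y: "\<nexists>c. T y = scale c (T x)"
    \<comment> \<open>T A maps range T to itself, so it has an eigenvalue c there. Then (T A - c) T
      has smaller rank than T, because the eigenvector is lost, but its value at x is T y - c T x,
      which is nonzero; this contradicts minimality.\<close>
    obtain A where A: "A \<in> \<A>" "A (T x) = y" using transitive[OF x] by blast
    have TAA: "(\<lambda>v. T (A v)) \<in> \<A>" by (rule generated_algebra.comp[OF TA A(1)])
    have V: "subspace (range T)" by (rule T.subspace_image) simp
    obtain c w where w: "w \<in> range T" "w \<noteq> 0" "T (A w) = scale c w"
      using eigenvector_in_invariant_subspace[OF linear_generated[OF TAA] V _ _ x] by blast
    let ?D = "\<lambda>v. T (A v) + scale (-c) v"
    have D: "?D \<in> \<A>"
      by (intro generated_algebra.add[OF TAA] generated_algebra.scale generated_algebra.ident)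
    have "(\<lambda>v. ?D (T v)) \<in> \<A>" by (rule generated_algebra.comp[OF D TA])
    moreover have "?D (T x) \<noteq> 0" using y A by auto
    ultimately have "P (\<lambda>v. ?D (T v))" unfolding P_def by blast
    then have "dim (range T) \<le> dim (range (\<lambda>v. ?D (T v)))" by (rule min)
    also have "range (\<lambda>v. ?D (T v)) = ?D ` range T" by auto
    also have "dim \<dots> < dim (range T)"
      by (rule dim_image_less[OF linear_generated[OF D] V w(1,2)]) (simp add: w(3))
    finally show False by simp
  qed
  with TA x show ?thesis by blast
qed

end

section \<open>From \<open>gl\<^sub>2\<close>-stable to \<open>GL\<^sub>2\<close>-stable subspaces\<close>

text \<open>The matrix 1 + s E_ij, over an arbitrary commutative ring because s will be a scalar,
  the indeterminate of a polynomial ring, or \<open>fps_X\<close>.\<close>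

definition elementary_line :: "2 \<Rightarrow> 2 \<Rightarrow> 'r \<Rightarrow> 'r::comm_ring_1^2^2" where
  "elementary_line i j s = (\<chi> a b. (if a = b then 1 else 0) + s * matrix_unit i j $ a $ b)"

lemma det_elementary_line: "det (elementary_line i j s) = (if i = j then 1 + s else 1)"
  using exhaust_2[of i] exhaust_2[of j]
  by (auto simp: det_2 elementary_line_def matrix_unit_def)

lemma elementary_line_mult:
  "elementary_line i j s ** elementary_line i j t
     = elementary_line i j (s + t + (if i = j then s * t else 0))"
  using exhaust_2[of i] exhaust_2[of j]
  by (auto simp: vec_eq_iff matrix_matrix_mult_def elementary_line_def matrix_unit_def UNIV_2
      forall_2 algebra_simps)

lemma elementary_line_0: "elementary_line i j 0 = mat 1"
  by (simp add: elementary_line_def mat_def)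

text \<open>A bridge between the two ways in which \<open>\<rho>\<close> enters: its values at
  scalar matrices, and the formal substitution of \<open>fps_X\<close> in \<open>gl_act\<close>.
  Both are read off from this one polynomial.\<close>

definition line_poly :: "'k::comm_ring_1 matrix_poly \<Rightarrow> 2 \<Rightarrow> 2 \<Rightarrow> 'k poly" where
  "line_poly P i j = eval_matrix_poly (\<lambda>c. [:c:]) P (elementary_line i j [:0, 1:])"

lemma poly_line_poly:
  fixes P :: "'k::field matrix_poly"
  shows "poly (line_poly P i j) s = eval_matrix_poly (\<lambda>c. c) P (elementary_line i j s)"
proof -
  have "poly (elementary_line i j [:0, 1:] $ a $ b) s = elementary_line i j s $ a $ b" for a b
    by (auto simp: elementary_line_def matrix_unit_def)
  then show ?thesis
    by (simp add: line_poly_def eval_matrix_poly_def poly_sum poly_prod case_prod_unfold)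
qed

lemma fps_line_poly:
  fixes P :: "'k::field matrix_poly"
  shows "fps_of_poly (line_poly P i j) = eval_matrix_poly fps_const P (elementary_line i j fps_X)"
proof -
  have "fps_of_poly (elementary_line i j [:0, 1:] $ a $ b) = (elementary_line i j fps_X :: 'k fps^2^2) $ a $ b" for a b
    by (auto simp: elementary_line_def matrix_unit_def fps_of_poly_pCons one_pCons)
  then show ?thesis
    by (simp add: line_poly_def eval_matrix_poly_def fps_of_poly_sum fps_of_poly_prod
      fps_of_poly_mult fps_of_poly_power fps_of_poly_smult case_prod_unfold)
qed

text \<open>Multiplying the difference by d gives a polynomial that vanishes on all of the infinite
  field k. The points left out will be those where 1 + s E_ij is singular.\<close>

lemma poly_eqI_cofinite:
  fixes p q :: "'k::field_char_0 poly"
  assumes "d \<noteq> 0" and "\<And>s. poly d s \<noteq> 0 \<Longrightarrow> poly p s = poly q s"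
  shows "p = q"
proof -
  have "(p - q) * d = 0"
  proof (rule ccontr)
    assume "(p - q) * d \<noteq> 0"
    then have "finite {s. poly ((p - q) * d) s = 0}" by (rule poly_roots_finite)
    moreover have "{s. poly ((p - q) * d) s = 0} = UNIV" using assms(2) by auto
    ultimately have "finite (UNIV :: 'k set)" by (simp only:)
    then show False using infinite_UNIV_char_0 by blast
  qed
  with assms(1) show ?thesis by simp
qed

lemma fps_power_nth_1:
  fixes a :: "'k::field"
  shows "fps_nth ((1 + fps_const a * fps_X) ^ n) 0 = 1" "fps_nth ((1 + fps_const a * fps_X) ^ n) 1 = of_nat n * a"
proof -
  show 0: "fps_nth ((1 + fps_const a * fps_X) ^ n) 0 = 1" for n by (induction n) simp_all
  show "fps_nth ((1 + fps_const a * fps_X) ^ n) 1 = of_nat n * a"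
    by (induction n) (simp_all add: 0, simp_all add: algebra_simps)
qed

section \<open>Coordinates on U and the curves \<open>\<rho>\<close> (1 + s E_ij)\<close>

context rational_GL2_module
begin

definition matrix_op :: "('u \<Rightarrow> 'u \<Rightarrow> 'k) \<Rightarrow> 'u \<Rightarrow> 'u" where
  "matrix_op M u = (\<Sum>b\<in>Basis. \<Sum>b'\<in>Basis. scaleU (representation Basis u b * M b' b) b')"

lemma vector_eqI:
  assumes "\<And>b. b \<in> Basis \<Longrightarrow> representation Basis u b = representation Basis v b"
  shows "u = v"
proof -
  have "u = (\<Sum>b\<in>Basis. scaleU (representation Basis u b) b)" for u
    using sum_representation_eq[OF independent_Basis _ finite_Basis order_refl] span_Basis by simp
  then show ?thesis using assms by (metis (no_types, lifting) sum.cong)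
qed

lemma representation_Basis:
  "b \<in> Basis \<Longrightarrow> representation Basis b c = (if c = b then 1 else 0)"
  using representation_basis[OF independent_Basis] by auto

lemma representation_matrix_op:
  assumes "b' \<in> Basis"
  shows "representation Basis (matrix_op M u) b' = (\<Sum>b\<in>Basis. representation Basis u b * M b' b)"
  using assms independent_Basis span_Basis finite_Basis
    by (simp add: matrix_op_def representation_sum representation_scale representation_Basis
        if_distrib
        cong: if_cong sum.cong)

lemma representation_vector:
  "representation Basis (u + v) b = representation Basis u b + representation Basis v b"
  "representation Basis (u - v) b = representation Basis u b - representation Basis v b"
  "representation Basis (scaleU c u) b = c * representation Basis u b"
  "representation Basis (sum f S) b = (\<Sum>x\<in>S. representation Basis (f x) b)"
  using independent_Basis span_Basis
  by (simp_all add: representation_add representation_diff representation_scale representation_sum)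

text \<open>The group elements on the line and the formal derivative in \<open>gl_act\<close> are
  tied to the same numerators over one denominator, a power of the determinant 1 + \<epsilon> s. The
  second formula is the derivative of that quotient at 0.\<close>

lemma elementary_line_coeffs:
  fixes i j
  defines "\<epsilon> \<equiv> if i = j then 1 else (0 :: 'k)"
  shows "\<exists>p N. (\<forall>b\<in>Basis. \<forall>b'\<in>Basis.
      (\<forall>s. 1 + \<epsilon> * s \<noteq> 0 \<longrightarrow>
        representation Basis (\<rho> (elementary_line i j s) b) b' = poly (p b' b) s / (1 + \<epsilon> * s) ^ N) \<and>
      fps_nth (fps_deriv (GL2_subst fps_const (matrix_coeff b' b)
         (mat 1 + (\<chi> a c. fps_X * fps_const (matrix_unit i j $ a $ c))))) 0
        = coeff (p b' b) 1 - of_nat N * \<epsilon> * coeff (p b' b) 0)"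
proof -
  \<comment> \<open>The same choice as inside \<open>GL2_subst\<close>, so that its value unfolds to
    this very numerator and exponent.\<close>
  define Pn where "Pn = (\<lambda>b' b. SOME (P, n). represents_on_GL2 P n (matrix_coeff b' b))"
  define n where "n = (\<lambda>b' b. snd (Pn b' b))"
  define q where "q = (\<lambda>b' b. line_poly (fst (Pn b' b)) i j)"
  \<comment> \<open>Any common upper bound of the pole orders serves; the sum is one.\<close>
  define N where "N = (\<Sum>b'\<in>Basis. \<Sum>b\<in>Basis. n b' b)"
  define p where "p = (\<lambda>b' b. q b' b * [:1, \<epsilon>:] ^ (N - n b' b))"
  have Pn_eq: "(SOME (P, n). represents_on_GL2 P n (matrix_coeff b' b)) = Pn b' b" for b' b
    by (simp add: Pn_def)
  have \<epsilon>: "det (elementary_line i j s) = 1 + \<epsilon> * s" for s :: 'k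
    by (simp add: det_elementary_line \<epsilon>_def)
  have "(\<forall>s. 1 + \<epsilon> * s \<noteq> 0 \<longrightarrow>
        representation Basis (\<rho> (elementary_line i j s) b) b' = poly (p b' b) s / (1 + \<epsilon> * s) ^ N) \<and>
      fps_nth (fps_deriv (GL2_subst fps_const (matrix_coeff b' b)
         (mat 1 + (\<chi> a c. fps_X * fps_const (matrix_unit i j $ a $ c))))) 0
        = coeff (p b' b) 1 - of_nat N * \<epsilon> * coeff (p b' b) 0"
    if b: "b \<in> Basis" "b' \<in> Basis" for b b'
  proof (intro conjI allI impI)
    have "\<exists>P n. represents_on_GL2 P n (matrix_coeff b' b)"
      using rho_rational[OF b] by (simp add: regular_on_GL2_def matrix_coeff_def[abs_def])
    then have "\<exists>x. case x of (P, n) \<Rightarrow> represents_on_GL2 P n (matrix_coeff b' b)" by auto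
    then have "case Pn b' b of (P, n) \<Rightarrow> represents_on_GL2 P n (matrix_coeff b' b)"
      unfolding Pn_def by (rule someI_ex)
    then have rep: "represents_on_GL2 (fst (Pn b' b)) (n b' b) (matrix_coeff b' b)"
      by (simp add: n_def case_prod_unfold)
    have nN: "n b' b \<le> N"
    proof -
      have "n b' b \<le> (\<Sum>b\<in>Basis. n b' b)" using b finite_Basis by (intro member_le_sum) auto
      also have "\<dots> \<le> N" unfolding N_def using b finite_Basis
        by (intro member_le_sum[of b' Basis "\<lambda>b'. \<Sum>b\<in>Basis. n b' b"]) auto
      finally show ?thesis .
    qed
    show "representation Basis (\<rho> (elementary_line i j s) b) b' = poly (p b' b) s / (1 + \<epsilon> * s) ^ N"
      if s: "1 + \<epsilon> * s \<noteq> 0" for s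
    proof -
      have "invertible (elementary_line i j s)" using s by (simp add: invertible_det_nz \<epsilon>)
      then have "representation Basis (\<rho> (elementary_line i j s) b) b' = poly (q b' b) s / (1 + \<epsilon> * s) ^ n b' b"
        using rep by (simp add: represents_on_GL2_def matrix_coeff_def q_def poly_line_poly \<epsilon>)
      also have "\<dots> = poly (p b' b) s / (1 + \<epsilon> * s) ^ N"
        using s nN by (simp add: p_def frac_eq_eq mult.assoc power_add[symmetric] mult.commute[of s])
      finally show ?thesis .
    qed
    have line: "mat 1 + (\<chi> a c. fps_X * fps_const (matrix_unit i j $ a $ c)) = (elementary_line i j fps_X :: 'k fps^2^2)"
      by (auto simp: vec_eq_iff mat_def elementary_line_def matrix_unit_def)
    define F where "F = GL2_subst fps_const (matrix_coeff b' b) (elementary_line i j fps_X :: 'k fps^2^2)"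
    define d where "d = 1 + fps_const \<epsilon> * (fps_X :: 'k fps)"
    have d: "det (elementary_line i j (fps_X :: 'k fps)) = d"
      by (simp add: det_elementary_line \<epsilon>_def d_def)
    have dp: "fps_of_poly [:1, \<epsilon>:] = d"
      by (simp add: d_def fps_of_poly_pCons mult.commute)
    have "fps_nth d 0 = 1" by (simp add: d_def)
    then have inv: "inverse d * d = 1" by (intro inverse_mult_eq_1) simp
    have "F = fps_of_poly (q b' b) * inverse d ^ n b' b"
      unfolding F_def GL2_subst_def Pn_eq
      by (simp add: Let_def case_prod_unfold q_def fps_line_poly n_def d)
    then have "F * d ^ N = fps_of_poly (q b' b) * (inverse d * d) ^ n b' b * d ^ (N - n b' b)"
      using nN by (simp add: power_mult_distrib power_add[symmetric] mult.assoc)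
    also have "\<dots> = fps_of_poly (p b' b)"
      by (simp add: inv p_def fps_of_poly_mult fps_of_poly_power dp)
    \<comment> \<open>As d^N begins with 1 + N \<epsilon> X, the coefficients of degree 0 and 1 in
      this identity determine those of F.\<close>
    finally have Fd: "F * d ^ N = fps_of_poly (p b' b)" .
    have "coeff (p b' b) 0 = fps_nth F 0"
      using arg_cong[OF Fd, of "\<lambda>f. fps_nth f 0"] by (simp add: d_def fps_power_nth_1)
    moreover have "coeff (p b' b) 1 = fps_nth F 0 * (of_nat N * \<epsilon>) + fps_nth F 1"
      using arg_cong[OF Fd, of "\<lambda>f. fps_nth f 1"] fps_power_nth_1[of \<epsilon> N]
      by (simp add: fps_mult_nth_1' d_def)
    ultimately show "fps_nth (fps_deriv (GL2_subst fps_const (matrix_coeff b' b)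
         (mat 1 + (\<chi> a c. fps_X * fps_const (matrix_unit i j $ a $ c))))) 0
        = coeff (p b' b) 1 - of_nat N * \<epsilon> * coeff (p b' b) 0"
      unfolding line F_def[symmetric] by simp
  qed
  then show ?thesis by blast
qed

text \<open>
  With \<open>\<epsilon> = (if i = j then 1 else 0)\<close>, the curve \<open>\<rho> (1 + s E\<^sub>i\<^sub>j) = (\<Sum>k. s\<^sup>k P\<^sub>k) / (1 + \<epsilon> s)\<^sup>N\<close> satisfies
  \<open>(k + 1) P\<^sub>k\<^sub>+\<^sub>1 + \<epsilon> k P\<^sub>k = P\<^sub>k P\<^sub>1\<close>, by differentiating the multiplicativity of \<open>\<rho>\<close> at \<open>t = 0\<close>, and
  \<open>P\<^sub>1 = gl_act E\<^sub>i\<^sub>j + N \<epsilon>\<close>. Hence all \<open>P\<^sub>k\<close> preserve a subspace preserved by \<open>gl_act E\<^sub>i\<^sub>j\<close>.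
\<close>

lemma elementary_line_preserves:
  fixes i j
  defines "\<epsilon> \<equiv> if i = j then 1 else (0 :: 'k)"
  assumes W: "subspace W" "\<And>w. w \<in> W \<Longrightarrow> gl_act (matrix_unit i j) w \<in> W"
    and s: "1 + \<epsilon> * s \<noteq> 0" and w: "w \<in> W"
  shows "\<rho> (elementary_line i j s) w \<in> W"
proof -
  let ?r = "representation Basis" and ?e = "elementary_line i j :: 'k \<Rightarrow> 'k^2^2"
  obtain p N where
    val: "\<And>b b' s. b \<in> Basis \<Longrightarrow> b' \<in> Basis \<Longrightarrow> 1 + \<epsilon> * s \<noteq> 0 \<Longrightarrow>
        ?r (\<rho> (?e s) b) b' = poly (p b' b) s / (1 + \<epsilon> * s) ^ N" and
    der: "\<And>b b'. b \<in> Basis \<Longrightarrow> b' \<in> Basis \<Longrightarrow> fps_nth (fps_deriv (GL2_subst fps_const (matrix_coeff b' b)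
         (mat 1 + (\<chi> a c. fps_X * fps_const (matrix_unit i j $ a $ c))))) 0
        = coeff (p b' b) 1 - of_nat N * \<epsilon> * coeff (p b' b) 0"
    using elementary_line_coeffs[of i j] unfolding \<epsilon>_def by blast
  have lin: "Vector_Spaces.linear scaleU scaleU (\<rho> (?e s))" and inv: "invertible (?e s)"
    if "1 + \<epsilon> * s \<noteq> 0" for s
    using that by (auto intro!: rho_linear simp: invertible_det_nz det_elementary_line \<epsilon>_def)
  have c0: "coeff (p b' b) 0 = (if b' = b then 1 else 0)" if "b \<in> Basis" "b' \<in> Basis" for b b'
  proof -
    have "coeff (p b' b) 0 = ?r b b'"
      using val[OF that, of 0] by (simp add: elementary_line_0 rho_one poly_0_coeff_0)
    also have "\<dots> = (if b' = b then 1 else 0)"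
      using that(1) by (rule representation_Basis)
    finally show ?thesis .
  qed
  have mult: "poly (p b' b) (s + t + \<epsilon> * (s * t)) = (\<Sum>c\<in>Basis. poly (p b' c) s * poly (p c b) t)"
    if b: "b \<in> Basis" "b' \<in> Basis" and s: "1 + \<epsilon> * s \<noteq> 0" and t: "1 + \<epsilon> * t \<noteq> 0" for b b' s t
  proof -
    let ?st = "s + t + \<epsilon> * (s * t)"
    have st: "1 + \<epsilon> * ?st = (1 + \<epsilon> * s) * (1 + \<epsilon> * t)"
      by (simp add: \<epsilon>_def algebra_simps)
    have ne: "1 + \<epsilon> * ?st \<noteq> 0" unfolding st using s t by simp
    have "?e ?st = ?e s ** ?e t" by (simp add: elementary_line_mult \<epsilon>_def)
    then have "?r (\<rho> (?e ?st) b) b' = ?r (\<rho> (?e s) (\<rho> (?e t) b)) b'"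
      by (simp add: rho_mult[OF inv[OF s] inv[OF t]])
    also have "\<dots> = (\<Sum>c\<in>Basis. ?r (\<rho> (?e t) b) c * ?r (\<rho> (?e s) c) b')"
      by (rule representation_sum_Basis[OF lin[OF s], symmetric])
    also have "\<dots> = (\<Sum>c\<in>Basis. poly (p b' c) s * poly (p c b) t / ((1 + \<epsilon> * s) ^ N * (1 + \<epsilon> * t) ^ N))"
      by (intro sum.cong refl) (simp add: val b s t mult_ac)
    also have "\<dots> = (\<Sum>c\<in>Basis. poly (p b' c) s * poly (p c b) t) / (1 + \<epsilon> * ?st) ^ N"
      unfolding st power_mult_distrib by (simp add: sum_divide_distrib)
    finally show ?thesis using ne by (simp only: val[OF b ne]) simp
  qed
  have d: "[:1, \<epsilon>:] \<noteq> 0" by simp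
  have ode: "pderiv (p b' b) * [:1, \<epsilon>:] = (\<Sum>c\<in>Basis. smult (coeff (p c b) 1) (p b' c))"
    if b: "b \<in> Basis" "b' \<in> Basis" for b b'
  proof (rule poly_eqI_cofinite[OF d])
    fix s assume "poly [:1, \<epsilon>:] s \<noteq> 0"
    then have s: "1 + \<epsilon> * s \<noteq> 0" by (simp add: mult.commute)
    \<comment> \<open>For fixed s the group law s + t + \<epsilon> s t is a polynomial of degree at
      most 1 in t; comparing t-derivatives at t = 0 gives the differential equation.\<close>
    have "pcompose (p b' b) [:s, 1 + \<epsilon> * s:] = (\<Sum>c\<in>Basis. smult (poly (p b' c) s) (p c b))"
    proof (rule poly_eqI_cofinite[OF d])
      fix t assume "poly [:1, \<epsilon>:] t \<noteq> 0"
      then have t: "1 + \<epsilon> * t \<noteq> 0" by (simp add: mult.commute)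
      show "poly (pcompose (p b' b) [:s, 1 + \<epsilon> * s:]) t = poly (\<Sum>c\<in>Basis. smult (poly (p b' c) s) (p c b)) t"
        using mult[OF b s t] by (simp add: poly_pcompose poly_sum algebra_simps)
    qed
    then have "poly (pderiv (pcompose (p b' b) [:s, 1 + \<epsilon> * s:])) 0
        = poly (pderiv (\<Sum>c\<in>Basis. smult (poly (p b' c) s) (p c b))) 0" by simp
    then show "poly (pderiv (p b' b) * [:1, \<epsilon>:]) s = poly (\<Sum>c\<in>Basis. smult (coeff (p c b) 1) (p b' c)) s"
      by (simp add: pderiv_pcompose poly_pcompose pderiv_pCons is_deriv_sum[OF is_deriv_pderiv]
          pderiv_smult poly_sum poly_0_coeff_0 coeff_pderiv coeff_sum algebra_simps)
  qed
  define Q where "Q = (\<lambda>k. matrix_op (\<lambda>b' b. coeff (p b' b) k))"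
  have Q0: "Q 0 u = u" for u
    by (rule vector_eqI) (simp add: Q_def representation_matrix_op c0 if_distrib finite_Basis cong: if_cong)
  have Q1: "Q 1 u = gl_act (matrix_unit i j) u + scaleU (of_nat N * \<epsilon>) u" for u
  proof -
    have "gl_act (matrix_unit i j) u = matrix_op (\<lambda>b' b. coeff (p b' b) 1 - of_nat N * \<epsilon> * coeff (p b' b) 0) u"
      unfolding gl_act_def matrix_op_def by (intro sum.cong refl) (simp only: der)
    then have "gl_act (matrix_unit i j) u = Q 1 u - scaleU (of_nat N * \<epsilon>) (Q 0 u)"
      by (intro vector_eqI) (simp add: Q_def representation_matrix_op representation_vector
          right_diff_distrib sum_subtractf sum_distrib_left mult_ac)
    then show ?thesis by (simp add: Q0)
  qed
  have Qrec: "scaleU (of_nat (Suc k)) (Q (Suc k) u) = Q k (Q 1 u) - scaleU (\<epsilon> * of_nat k) (Q k u)" for k u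
  proof (rule vector_eqI)
    fix b' assume b': "b' \<in> Basis"
    have c: "of_nat (Suc k) * coeff (p b' b) (Suc k) + \<epsilon> * of_nat k * coeff (p b' b) k
        = (\<Sum>c\<in>Basis. coeff (p c b) 1 * coeff (p b' c) k)" if "b \<in> Basis" for b
      using arg_cong[OF ode[OF that b'], of "\<lambda>q. coeff q k"]
      by (cases k) (simp_all add: coeff_pderiv coeff_sum algebra_simps)
    have "?r (Q k (Q 1 u)) b' = (\<Sum>c\<in>Basis. (\<Sum>b\<in>Basis. ?r u b * coeff (p c b) 1) * coeff (p b' c) k)"
      by (simp add: Q_def representation_matrix_op b')
    also have "\<dots> = (\<Sum>b\<in>Basis. ?r u b * (\<Sum>c\<in>Basis. coeff (p c b) 1 * coeff (p b' c) k))"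
      unfolding sum_distrib_left sum_distrib_right by (subst sum.swap) (simp add: mult.assoc)
    also have "\<dots> = (\<Sum>b\<in>Basis. ?r u b * (of_nat (Suc k) * coeff (p b' b) (Suc k) + \<epsilon> * of_nat k * coeff (p b' b) k))"
      by (simp only: c cong: sum.cong)
    finally show "?r (scaleU (of_nat (Suc k)) (Q (Suc k) u)) b' = ?r (Q k (Q 1 u) - scaleU (\<epsilon> * of_nat k) (Q k u)) b'"
      by (simp add: representation_vector Q_def representation_matrix_op b' sum_distrib_left
          distrib_left sum.distrib algebra_simps)
  qed
  have QW: "Q k w \<in> W" if "w \<in> W" for k w
    using that
  proof (induction k arbitrary: w)
    case 0
    then show ?case by (simp add: Q0)
  next
    case (Suc k)
    have "Q 1 w \<in> W"
      unfolding Q1 by (intro subspace_add subspace_scale W Suc.prems)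
    then have "Q k (Q 1 w) - scaleU (\<epsilon> * of_nat k) (Q k w) \<in> W"
      by (intro subspace_diff subspace_scale W(1) Suc.IH Suc.prems)
    \<comment> \<open>Characteristic zero lets the recursion be solved for the next
      coefficient.\<close>
    then have "scaleU (1 / of_nat (Suc k)) (scaleU (of_nat (Suc k)) (Q (Suc k) w)) \<in> W"
      unfolding Qrec by (intro subspace_scale W(1))
    then show ?case by (simp del: of_nat_Suc)
  qed
  define D where "D = (\<Sum>b'\<in>Basis. \<Sum>b\<in>Basis. degree (p b' b))"
  have "\<rho> (?e s) w = (\<Sum>k\<le>D. scaleU (s ^ k / (1 + \<epsilon> * s) ^ N) (Q k w))"
  proof (rule vector_eqI)
    fix b' assume b': "b' \<in> Basis"
    have deg: "degree (p b' b) \<le> D" if b: "b \<in> Basis" for b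
    proof -
      have "degree (p b' b) \<le> (\<Sum>b\<in>Basis. degree (p b' b))"
        using b finite_Basis by (intro member_le_sum) auto
      also have "\<dots> \<le> D" unfolding D_def using b' finite_Basis
        by (intro member_le_sum[of b' Basis "\<lambda>b'. \<Sum>b\<in>Basis. degree (p b' b)"]) auto
      finally show ?thesis .
    qed
    have pD: "poly (p b' b) s = (\<Sum>k\<le>D. coeff (p b' b) k * s ^ k)" if "b \<in> Basis" for b
      unfolding poly_altdef
      by (rule sum.mono_neutral_left) (use deg[OF that] in \<open>auto simp: coeff_eq_0\<close>)
    have "?r (\<rho> (?e s) w) b' = (\<Sum>b\<in>Basis. ?r w b * ?r (\<rho> (?e s) b) b')"
      by (rule representation_sum_Basis[OF lin[OF s], symmetric])
    also have "\<dots> = (\<Sum>b\<in>Basis. ?r w b * ((\<Sum>k\<le>D. coeff (p b' b) k * s ^ k) / (1 + \<epsilon> * s) ^ N))"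
      by (intro sum.cong refl arg_cong2[where f="(*)"])
        (simp add: val b' s pD)
    also have "\<dots> = (\<Sum>k\<le>D. s ^ k / (1 + \<epsilon> * s) ^ N * (\<Sum>b\<in>Basis. ?r w b * coeff (p b' b) k))"
      unfolding sum_distrib_left sum_divide_distrib by (subst sum.swap) (simp add: mult_ac)
    finally show "?r (\<rho> (?e s) w) b' = ?r (\<Sum>k\<le>D. scaleU (s ^ k / (1 + \<epsilon> * s) ^ N) (Q k w)) b'"
      by (simp add: representation_vector Q_def representation_matrix_op b')
  qed
  then show ?thesis by (simp only:) (intro subspace_sum subspace_scale W(1) QW w)
qed

end

text \<open>The LDU decomposition with pivot g_11. The diagonal part diag(g_11, det g / g_11) is
  split in two, and its parameters are shifted by 1 since the lines start at the identity.\<close>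

lemma elementary_factorization:
  fixes g :: "'k::field^2^2"
  assumes g: "invertible g" "g $ 1 $ 1 \<noteq> 0"
  shows "\<exists>r s t u. 1 + s \<noteq> 0 \<and> 1 + t \<noteq> 0 \<and>
    g = elementary_line 2 1 r ** (elementary_line 1 1 s ** (elementary_line 2 2 t ** elementary_line 1 2 u))"
proof -
  let ?a = "g $ 1 $ 1" and ?b = "g $ 1 $ 2" and ?c = "g $ 2 $ 1" and ?d = "g $ 2 $ 2"
  have det: "?a * ?d - ?b * ?c \<noteq> 0" using g(1) by (simp add: invertible_det_nz det_2)
  show ?thesis
  proof (intro exI conjI)
    show "1 + (?a - 1) \<noteq> 0" using g(2) by simp
    show "1 + ((?a * ?d - ?b * ?c) / ?a - 1) \<noteq> 0" using det g(2) by simp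
    show "g = elementary_line 2 1 (?c / ?a) ** (elementary_line 1 1 (?a - 1) **
        (elementary_line 2 2 ((?a * ?d - ?b * ?c) / ?a - 1) ** elementary_line 1 2 (?b / ?a)))"
      using g(2) by (simp add: vec_eq_iff matrix_matrix_mult_def elementary_line_def matrix_unit_def
          UNIV_2 forall_2 field_simps)
  qed
qed

lemma (in rational_GL2_module) gl_stable_imp_GL_stable:
  assumes W: "subspace W" "\<And>i j w. w \<in> W \<Longrightarrow> gl_act (matrix_unit i j) w \<in> W"
    and g: "invertible g" and w: "w \<in> W"
  shows "\<rho> g w \<in> W"
proof -
  have el: "\<rho> (elementary_line i j s) w \<in> W"
    if "i = j \<Longrightarrow> 1 + s \<noteq> 0" "w \<in> W" for i j s w
    by (rule elementary_line_preserves) (use that W in auto)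
  have inv: "invertible (elementary_line i j s)" if "i = j \<Longrightarrow> 1 + s \<noteq> 0" for i j and s :: 'k
    using that by (simp add: invertible_det_nz det_elementary_line)
  have big: "\<rho> g w \<in> W" if "invertible g" "g $ 1 $ 1 \<noteq> 0" "w \<in> W" for g w
  proof -
    obtain r s t u where st: "1 + s \<noteq> 0" "1 + t \<noteq> 0" and
      g: "g = elementary_line 2 1 r ** (elementary_line 1 1 s ** (elementary_line 2 2 t ** elementary_line 1 2 u))"
      using elementary_factorization[OF \<open>invertible g\<close> \<open>g $ 1 $ 1 \<noteq> 0\<close>] by blast
    have i: "invertible (elementary_line 2 1 r)" "invertible (elementary_line 1 1 s)"
      "invertible (elementary_line 2 2 t)" "invertible (elementary_line 1 2 u)"
      using st by (auto intro!: inv)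
    have "\<rho> g w = \<rho> (elementary_line 2 1 r) (\<rho> (elementary_line 1 1 s)
        (\<rho> (elementary_line 2 2 t) (\<rho> (elementary_line 1 2 u) w)))"
      unfolding g by (simp add: rho_mult i invertible_mult)
    also have "\<dots> \<in> W" using st \<open>w \<in> W\<close> by (intro el) auto
    finally show ?thesis .
  qed
  show ?thesis
  proof (cases "g $ 1 $ 1 = 0")
    case False
    then show ?thesis using big g w by blast
  next
    case True
    \<comment> \<open>With a zero pivot, adding the second row to the first makes the pivot g_21,
      which is nonzero because g is invertible. The inverse row operation is applied
      afterwards.\<close>
    let ?e = "elementary_line 1 2 :: 'k \<Rightarrow> 'k^2^2"
    have i: "invertible (?e 1)" "invertible (?e (-1))" by (auto intro: inv)
    have ig: "invertible (?e 1 ** g)" by (rule invertible_mult[OF i(1) g])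
    have "g $ 2 $ 1 \<noteq> 0" using g True by (auto simp: invertible_det_nz det_2)
    then have "(?e 1 ** g) $ 1 $ 1 \<noteq> 0"
      using True by (simp add: matrix_matrix_mult_def UNIV_2 elementary_line_def matrix_unit_def)
    then have "\<rho> (?e 1 ** g) w \<in> W" using big ig w by blast
    then have "\<rho> (?e (-1)) (\<rho> (?e 1 ** g) w) \<in> W" by (intro el) auto
    also have "\<rho> (?e (-1)) (\<rho> (?e 1 ** g) w) = \<rho> ((?e (-1) ** ?e 1) ** g) w"
      by (simp add: rho_mult[OF i(2) ig, symmetric] matrix_mul_assoc)
    also have "?e (-1) ** ?e 1 = mat 1" by (simp add: elementary_line_mult elementary_line_0)
    finally show ?thesis by simp
  qed
qed

section \<open>Submodules of tensor modules\<close>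

lemma fconst_hom:
  fixes a b :: "'k::field_char_0" and f :: "'i \<Rightarrow> 'k"
  shows "fconst (a + b) = fconst a + fconst b" "fconst (a * b) = fconst a * fconst b"
  "fconst (0 :: 'k) = 0" "fconst (1 :: 'k) = 1" "fconst (sum f S) = (\<Sum>x\<in>S. fconst (f x))"
proof -
  show add: "fconst (a + b) = fconst a + fconst b" for a b :: 'k
    by (simp add: fconst_def const_add)
  show "fconst (a * b) = fconst a * fconst b" "fconst (1 :: 'k) = 1"
    by (simp_all add: fconst_def const_mult[symmetric] const_one)
  show zero: "fconst (0 :: 'k) = 0" by (simp add: fconst_def const_zero)
  show "fconst (sum f S) = (\<Sum>x\<in>S. fconst (f x))"
    by (induction S rule: infinite_finite_induct) (simp_all add: add zero)
qed

text \<open>Used to compress an element of F (x) U to a vector of U without losing a prescribed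
  nonzero coefficient.\<close>

lemma fract_functional_exists:
  fixes x :: "'k::field_char_0 sphere fract"
  assumes "x \<noteq> 0"
  shows "\<exists>\<mu>::'k sphere fract \<Rightarrow> 'k. \<mu> x = 1 \<and> (\<forall>f g. \<mu> (f + g) = \<mu> f + \<mu> g) \<and> (\<forall>f c. \<mu> (f * fconst c) = \<mu> f * c)"
proof -
  interpret vector_space "\<lambda>(c :: 'k) (f :: 'k sphere fract). f * fconst c"
    by unfold_locales (simp_all add: fconst_hom algebra_simps)
  interpret vector_space_pair "\<lambda>(c :: 'k) (f :: 'k sphere fract). f * fconst c" "\<lambda>(c :: 'k) d. d * c"
    by unfold_locales (simp_all add: algebra_simps)
  have "independent {x}" using assms by simp
  then obtain \<mu> where \<mu>: "Vector_Spaces.linear (\<lambda>c f. f * fconst c) (\<lambda>c d. d * c) \<mu>" "\<mu> x = 1"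
    using linear_independent_extend[of "{x}" "\<lambda>_. 1"] by auto
  then show ?thesis unfolding Vector_Spaces.linear_iff by blast
qed

lemma rot_in_vector_fields: "rot a b \<in> vector_fields"
  by (simp add: vector_fields_def derivations_def is_deriv_add[OF is_deriv_rot]
      is_deriv_mult[OF is_deriv_rot] rot_const)

lemma scaled_vector_field: "\<eta> \<in> vector_fields \<Longrightarrow> (\<lambda>a. f * \<eta> a) \<in> vector_fields"
  unfolding vector_fields_def by (rule derivations_scale) simp_all

section \<open>Operators of U extended to F (x) U\<close>

context rational_GL2_module
begin

text \<open>The F-linear operator 1 (x) T, in the coordinates of
  \<open>tensor_space\<close>.\<close>

definition extend_op :: "('u \<Rightarrow> 'u) \<Rightarrow> ('u \<Rightarrow> 'k sphere fract) \<Rightarrow> 'u \<Rightarrow> 'k sphere fract" where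
  "extend_op T t = (\<lambda>c. \<Sum>b\<in>Basis. t b * fconst (representation Basis (T b) c))"

lemma extend_op_ident:
  assumes "\<And>b. b \<notin> Basis \<Longrightarrow> t b = 0"
  shows "extend_op (\<lambda>u. u) t = t"
  by (rule ext) (use assms finite_Basis in \<open>simp add: extend_op_def representation_Basis fconst_hom if_distrib
      cong: if_cong sum.cong\<close>)

lemma extend_op_add: "extend_op (\<lambda>u. S u + T u) t = (\<lambda>c. extend_op S t c + extend_op T t c)"
  by (rule ext) (simp add: extend_op_def representation_vector fconst_hom distrib_left sum.distrib)

lemma extend_op_scale: "extend_op (\<lambda>u. scaleU k (T u)) t = (\<lambda>c. fconst k * extend_op T t c)"
  by (rule ext) (simp add: extend_op_def representation_vector fconst_hom sum_distrib_left mult_ac)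

lemma extend_op_comp:
  assumes S: "Vector_Spaces.linear scaleU scaleU S"
  shows "extend_op (\<lambda>u. S (T u)) t = extend_op S (extend_op T t)"
proof
  fix c
  have r: "representation Basis (S (T b)) c
      = (\<Sum>d\<in>Basis. representation Basis (T b) d * representation Basis (S d) c)" for b
    by (rule representation_sum_Basis[OF S, symmetric])
  have "extend_op (\<lambda>u. S (T u)) t c = (\<Sum>b\<in>Basis. \<Sum>d\<in>Basis. t b *
      (fconst (representation Basis (T b) d) * fconst (representation Basis (S d) c)))"
    by (simp add: extend_op_def r fconst_hom sum_distrib_left)
  also have "\<dots> = extend_op S (extend_op T t) c"
    unfolding extend_op_def sum_distrib_right by (subst sum.swap) (simp add: mult.assoc)
  finally show "extend_op (\<lambda>u. S (T u)) t c = extend_op S (extend_op T t) c" .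
qed

lemma extend_op_mult: "extend_op T (\<lambda>b. g * t b) = (\<lambda>c. g * extend_op T t c)"
  by (rule ext) (simp add: extend_op_def sum_distrib_left mult.assoc)

text \<open>
  The failure of \<open>act\<close> to be \<open>A\<close>-linear in the vector field isolates the \<open>gl\<^sub>2\<close>-part: for
  \<open>\<eta> = h \<partial>/\<partial>t\<^sub>j\<close>, the operator \<open>act (t\<^sub>q \<eta>) - t\<^sub>q act \<eta>\<close> is \<open>h \<otimes> E\<^sub>q\<^sub>j\<close>.
\<close>

lemma tensor_act_defect:
  fixes h q j
  defines "\<eta> \<equiv> rot h (chart_axis h j)"
  assumes t: "t \<in> tensor_space h"
  shows "tensor_act h (\<lambda>a. chart_param h q * \<eta> a) t c
    = to_fract (chart_param h q) * tensor_act h \<eta> t c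
      + to_fract (coord h) * extend_op (gl_act (matrix_unit q j)) t c"
proof -
  let ?f = "chart_param h q" and ?h = "to_fract (coord h) :: 'k sphere fract"
  have cc: "chart_coeff h \<eta> i = (if i = j then ?h else 0)" for i
    by (simp add: chart_coeff_def \<eta>_def chart_param_def rot_coord)
  have ccf: "chart_coeff h (\<lambda>a. ?f * \<eta> a) i = to_fract ?f * chart_coeff h \<eta> i" for i
    by (simp add: chart_coeff_def)
  have cr: "chart_coeff h \<eta> i \<in> chart_ring h" for i
    unfolding chart_coeff_def by (rule to_fract_in_chart_ring)
  \<comment> \<open>The first summand, from differentiating t_q by t_p, is the only source of the
    defect.\<close>
  have d: "chart_deriv h p (to_fract ?f * chart_coeff h \<eta> i)
      = (if p = q then chart_coeff h \<eta> i else 0) + to_fract ?f * chart_deriv h p (chart_coeff h \<eta> i)" for p i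
    unfolding derivationsD(2)[OF chart_deriv_in_derivations to_fract_in_chart_ring cr]
    by (simp add: chart_deriv_param)
  have pa: "pure_act h (\<lambda>a. ?f * \<eta> a) g b c = to_fract ?f * pure_act h \<eta> g b c
      + ?h * (g * fconst (representation Basis (gl_act (matrix_unit q j) b) c))" for g b
  proof -
    have e: "(\<Sum>p\<in>UNIV. \<Sum>i\<in>UNIV. g * (if p = q then chart_coeff h \<eta> i else 0) * w p i)
      = ?h * (g * w q j)" for w :: "2 \<Rightarrow> 2 \<Rightarrow> 'k sphere fract"
    proof -
      have "g * (if p = q then chart_coeff h \<eta> i else 0) * w p i
          = (if i = j then if p = q then ?h * (g * w p i) else 0 else 0)" for p i
        by (simp add: cc)
      then show ?thesis by simp
    qed
    show ?thesis
      unfolding pure_act_def ccf d pure_tensor_def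
        e[of "\<lambda>p i. fconst (representation Basis (gl_act (matrix_unit p i) b) c)", symmetric]
      by (simp add: sum_distrib_left sum.distrib distrib_left distrib_right mult_ac)
  qed
  show ?thesis
    unfolding tensor_act_def pa extend_op_def by (simp add: sum.distrib sum_distrib_left)
qed

end

section \<open>Pure tensors and submodules over a simple U\<close>

locale simple_GL2_module = rational_GL2_module scaleU Basis \<rho>
  for scaleU :: "'k::{alg_closed_field, field_char_0} \<Rightarrow> 'u::ab_group_add \<Rightarrow> 'u" and Basis \<rho> +
  assumes simple: simple
begin

sublocale irreducible_operators scaleU Basis "{gl_act (matrix_unit i j) |i j. True}"
proof (intro irreducible_operators.intro irreducible_operators_axioms.intro finite_dimensional_vector_space_axioms)
  show "Vector_Spaces.linear scaleU scaleU g" if "g \<in> {gl_act (matrix_unit i j) |i j. True}" for g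
    using that linear_gl_act by auto
  show "W = {0} \<or> W = UNIV"
    if W: "subspace W" "\<And>g w. g \<in> {gl_act (matrix_unit i j) |i j. True} \<Longrightarrow> w \<in> W \<Longrightarrow> g w \<in> W" for W
  proof -
    have "gl_act (matrix_unit i j) w \<in> W" if "w \<in> W" for i j w
      using W(2) that by auto
    then have "\<forall>g. invertible g \<longrightarrow> (\<forall>w\<in>W. \<rho> g w \<in> W)"
      by (intro allI impI ballI gl_stable_imp_GL_stable[OF W(1)])
    moreover have "subspace W \<and> (\<forall>g. invertible g \<longrightarrow> (\<forall>w\<in>W. \<rho> g w \<in> W)) \<longrightarrow> W = {0} \<or> W = UNIV"
      using simple unfolding simple_def by (elim conjE) (rule spec)
    ultimately show ?thesis using W(1) by simp
  qed
  show "\<exists>v::'u. v \<noteq> 0" using simple unfolding simple_def by blast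
qed

text \<open>In the application L is the image of a submodule, closed under A but possibly not under
  division by h. Each generator therefore costs a factor h; the exponent grows with the construction
  of T but is the same for all of L.\<close>

lemma generated_acts:
  fixes L :: "('u \<Rightarrow> 'k sphere fract) set" and h :: "'k sphere"
  assumes add: "\<And>t t'. t \<in> L \<Longrightarrow> t' \<in> L \<Longrightarrow> (\<lambda>b. t b + t' b) \<in> L"
    and mult: "\<And>a t. t \<in> L \<Longrightarrow> (\<lambda>b. to_fract a * t b) \<in> L"
    and supp: "\<And>t b. t \<in> L \<Longrightarrow> b \<notin> Basis \<Longrightarrow> t b = 0"
    and gen: "\<And>t i j. t \<in> L \<Longrightarrow> (\<lambda>b. to_fract h * extend_op (gl_act (matrix_unit i j)) t b) \<in> L"
    and T: "T \<in> \<A>"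
  shows "\<exists>n. \<forall>t\<in>L. (\<lambda>b. to_fract (h ^ n) * extend_op T t b) \<in> L"
  using T
proof (induction rule: generated_algebra.induct)
  case (generator g)
  then show ?case using gen by (intro exI[of _ 1]) auto
next
  case ident
  show ?case by (intro exI[of _ 0]) (simp add: extend_op_ident supp)
next
  case (add S T)
  then obtain m n where m: "\<And>t. t \<in> L \<Longrightarrow> (\<lambda>b. to_fract (h ^ m) * extend_op S t b) \<in> L"
    and n: "\<And>t. t \<in> L \<Longrightarrow> (\<lambda>b. to_fract (h ^ n) * extend_op T t b) \<in> L" by blast
  have "(\<lambda>b. to_fract (h ^ n) * (to_fract (h ^ m) * extend_op S t b)
      + to_fract (h ^ m) * (to_fract (h ^ n) * extend_op T t b)) \<in> L" if "t \<in> L" for t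
    by (intro assms(1) mult m n that)
  then show ?case
    by (intro exI[of _ "m + n"]) (simp add: extend_op_add power_add algebra_simps)
next
  case (scale T k)
  then obtain n where n: "\<And>t. t \<in> L \<Longrightarrow> (\<lambda>b. to_fract (h ^ n) * extend_op T t b) \<in> L" by blast
  have "(\<lambda>b. to_fract (const k) * (to_fract (h ^ n) * extend_op T t b)) \<in> L" if "t \<in> L" for t
    by (intro mult n that)
  then show ?case
    by (intro exI[of _ n]) (simp add: extend_op_scale fconst_def algebra_simps)
next
  case (comp S T)
  then obtain m n where m: "\<And>t. t \<in> L \<Longrightarrow> (\<lambda>b. to_fract (h ^ m) * extend_op S t b) \<in> L"
    and n: "\<And>t. t \<in> L \<Longrightarrow> (\<lambda>b. to_fract (h ^ n) * extend_op T t b) \<in> L" by blast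
  have "(\<lambda>b. to_fract (h ^ m) * extend_op S (\<lambda>b. to_fract (h ^ n) * extend_op T t b) b) \<in> L" if "t \<in> L" for t
    by (intro m n that)
  then show ?case
    by (intro exI[of _ "m + n"])
      (simp add: extend_op_comp[OF linear_generated[OF comp.hyps(1)], of T] extend_op_mult power_add algebra_simps)
qed

text \<open>Write the rank-one operator as T v = \<xi>(v) u. For B in the algebra, T B sends t to g0
  (x) u, where g0 is the sum of the t_b \<xi>(B b), and an operator C with C u = b moves this on to
  g0 (x) b. The point is to choose B so that g0 is nonzero.\<close>

lemma contains_pure_tensors:
  fixes L :: "('u \<Rightarrow> 'k sphere fract) set" and h :: "'k sphere"
  assumes add: "\<And>t t'. t \<in> L \<Longrightarrow> t' \<in> L \<Longrightarrow> (\<lambda>b. t b + t' b) \<in> L"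
    and mult: "\<And>a t. t \<in> L \<Longrightarrow> (\<lambda>b. to_fract a * t b) \<in> L"
    and supp: "\<And>t b. t \<in> L \<Longrightarrow> b \<notin> Basis \<Longrightarrow> t b = 0"
    and gen: "\<And>t i j. t \<in> L \<Longrightarrow> (\<lambda>b. to_fract h * extend_op (gl_act (matrix_unit i j)) t b) \<in> L"
    and h: "h \<noteq> 0" and t: "t \<in> L" "t b0 \<noteq> 0"
  shows "\<exists>g. g \<noteq> 0 \<and> (\<forall>b\<in>Basis. pure_tensor g b \<in> L)"
proof -
  have acts: "\<exists>n. \<forall>t\<in>L. (\<lambda>b. to_fract (h ^ n) * extend_op T t b) \<in> L" if "T \<in> \<A>" for T
    by (rule generated_acts[of L h T]) (fact add mult supp gen that)+
  obtain T u v where T: "T \<in> \<A>" and u: "u \<noteq> 0" and v: "T v \<noteq> 0" and ex: "\<forall>v. \<exists>c. T v = scaleU c u"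
    using rank_one_in_generated by (elim bexE exE conjE)
  obtain \<xi> where \<xi>: "\<And>v. T v = scaleU (\<xi> v) u" using choice[OF ex] by (elim exE) (simp only:)
  have b0: "b0 \<in> Basis" using supp[OF t(1)] t(2) by blast
  obtain \<mu> :: "'k sphere fract \<Rightarrow> 'k" where \<mu>: "\<mu> (t b0) = 1" "\<And>f g. \<mu> (f + g) = \<mu> f + \<mu> g"
    "\<And>f c. \<mu> (f * fconst c) = \<mu> f * c"
    using fract_functional_exists[OF t(2)] by blast
  have \<mu>0: "\<mu> 0 = 0" using \<mu>(3)[of 0 0] by simp
  have \<mu>sum: "\<mu> (sum f S) = (\<Sum>x\<in>S. \<mu> (f x))" for f :: "'u \<Rightarrow> 'k sphere fract" and S
    by (induction S rule: infinite_finite_induct) (simp_all add: \<mu> \<mu>0)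
  \<comment> \<open>The image of t under \<mu> (x) 1, nonzero because its coordinate at b0 is 1.
    Once B w = v, it follows that \<mu>(g0) u = T v, which is nonzero, and so is g0.\<close>
  define w where "w = (\<Sum>b\<in>Basis. scaleU (\<mu> (t b)) b)"
  have "representation Basis w b0 = \<mu> (t b0)"
    using b0 finite_Basis by (simp add: w_def representation_vector representation_Basis if_distrib cong: if_cong sum.cong)
  then have "w \<noteq> 0" using \<mu>(1) representation_zero by (metis zero_neq_one)
  then obtain B where B: "B \<in> \<A>" "B w = v" using transitive by blast
  define g0 where "g0 = (\<Sum>b\<in>Basis. t b * fconst (\<xi> (B b)))"
  have TB: "(\<lambda>u. T (B u)) \<in> \<A>" by (rule generated_algebra.comp[OF T B(1)])
  interpret TB: Vector_Spaces.linear scaleU scaleU "\<lambda>u. T (B u)" by (rule linear_generated[OF TB])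
  have "T v = (\<Sum>b\<in>Basis. scaleU (\<mu> (t b)) (T (B b)))"
    using B(2) TB.sum[of "\<lambda>b. scaleU (\<mu> (t b)) b" Basis] by (simp add: w_def TB.scale)
  also have "\<dots> = scaleU (\<mu> g0) u"
    by (simp add: \<xi> g0_def \<mu>sum \<mu>(3) scale_sum_left)
  finally have "g0 \<noteq> 0" using v \<mu>0 by auto
  have "\<exists>n. pure_tensor (to_fract (h ^ n) * g0) b \<in> L" if b: "b \<in> Basis" for b
  proof -
    obtain C where C: "C \<in> \<A>" "C u = b" using transitive[OF u] by blast
    interpret C: Vector_Spaces.linear scaleU scaleU C by (rule linear_generated[OF C(1)])
    have "(\<lambda>u. C (T (B u))) \<in> \<A>" by (rule generated_algebra.comp[OF C(1) TB])
    then obtain n where "(\<lambda>c. to_fract (h ^ n) * extend_op (\<lambda>u. C (T (B u))) t c) \<in> L"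
      using acts t(1) by blast
    moreover have "extend_op (\<lambda>u. C (T (B u))) t c = g0 * fconst (representation Basis b c)" for c
      by (simp add: extend_op_def \<xi> C.scale C(2) representation_vector fconst_hom g0_def
          sum_distrib_right mult.assoc)
    ultimately show ?thesis unfolding pure_tensor_def by (auto simp: mult.assoc)
  qed
  then obtain n where n: "\<And>b. b \<in> Basis \<Longrightarrow> pure_tensor (to_fract (h ^ n b) * g0) b \<in> L" by metis
  define N where "N = (\<Sum>b\<in>Basis. n b)"
  have "pure_tensor (to_fract (h ^ N) * g0) b \<in> L" if b: "b \<in> Basis" for b
  proof -
    have "n b \<le> N" unfolding N_def using b finite_Basis by (intro member_le_sum) auto
    then have "h ^ N = h ^ (N - n b) * h ^ n b" by (simp add: power_add[symmetric])
    then show ?thesis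
      using mult[OF n[OF b], of "h ^ (N - n b)"] by (simp add: pure_tensor_def mult.assoc)
  qed
  moreover have "to_fract (h ^ N) * g0 \<noteq> 0" using h \<open>g0 \<noteq> 0\<close> by simp
  ultimately show ?thesis by blast
qed

lemma tensor_submodule_trivial:
  assumes M: "AV_module scaleM act"
    and fg: "finite S" "module.span scaleM S = UNIV"
    and \<phi>: "inj \<phi>" "chart_hom scaleM act h \<phi>"
    and N: "AV_module.submodule scaleM act N" "N \<noteq> {0}"
  shows "N = UNIV"
proof -
  interpret M: AV_module scaleM act by (rule M)
  have sub: "M.subspace N" and actN: "\<And>\<eta> m. \<eta> \<in> vector_fields \<Longrightarrow> m \<in> N \<Longrightarrow> act \<eta> m \<in> N"
    using N(1) unfolding M.submodule_def by auto
  have \<phi>_space: "\<phi> m \<in> tensor_space h" and \<phi>_add: "\<phi> (m + n) = (\<lambda>b. \<phi> m b + \<phi> n b)"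
    and \<phi>_scale: "\<phi> (scaleM a m) = (\<lambda>b. to_fract a * \<phi> m b)"
    and \<phi>_act: "\<eta> \<in> vector_fields \<Longrightarrow> \<phi> (act \<eta> m) = tensor_act h \<eta> (\<phi> m)" for m n a \<eta>
    using \<phi>(2) unfolding chart_hom_def by auto
  have \<phi>_0: "\<phi> 0 = (\<lambda>b. 0)" using \<phi>_scale[of 0 0] by simp
  have \<phi>_diff: "\<phi> (m - n) = (\<lambda>b. \<phi> m b - \<phi> n b)" for m n
    using \<phi>_add[of "m - n" n] by (auto simp: fun_eq_iff)
  define L where "L = \<phi> ` N"
  let ?h = "coord h :: 'k sphere"
  have L_add: "(\<lambda>b. t b + t' b) \<in> L" if "t \<in> L" "t' \<in> L" for t t'
    using that M.subspace_add[OF sub] unfolding L_def by (auto simp: \<phi>_add[symmetric])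
  have L_mult: "(\<lambda>b. to_fract a * t b) \<in> L" if "t \<in> L" for t a
    using that M.subspace_scale[OF sub] unfolding L_def by (auto simp: \<phi>_scale[symmetric])
  have L_supp: "t b = 0" if "t \<in> L" "b \<notin> Basis" for t b
    using that \<phi>_space unfolding L_def tensor_space_def by auto
  have L_gen: "(\<lambda>b. to_fract ?h * extend_op (gl_act (matrix_unit q j)) t b) \<in> L" if t: "t \<in> L" for t q j
  proof -
    obtain m where m: "m \<in> N" "t = \<phi> m" using t unfolding L_def by auto
    let ?\<eta> = "rot h (chart_axis h j) :: 'k sphere \<Rightarrow> 'k sphere" and ?f = "chart_param h q"
    note vf = rot_in_vector_fields[of h "chart_axis h j"]
    let ?m = "act (\<lambda>a. ?f * ?\<eta> a) m - scaleM ?f (act ?\<eta> m)"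
    have "?m \<in> N"
      by (intro M.subspace_diff M.subspace_scale sub actN vf scaled_vector_field m)
    moreover have "\<phi> ?m = (\<lambda>b. to_fract ?h * extend_op (gl_act (matrix_unit q j)) t b)"
      by (simp add: \<phi>_diff \<phi>_scale \<phi>_act vf scaled_vector_field m(2) tensor_act_defect[OF \<phi>_space])
    ultimately show ?thesis unfolding L_def by (metis imageI)
  qed
  obtain m0 where m0: "m0 \<in> N" "m0 \<noteq> 0" using N(2) M.subspace_0[OF sub] by blast
  then have "\<phi> m0 \<noteq> \<phi> 0" using \<phi>(1) by (auto dest: injD)
  then obtain b0 where b0: "\<phi> m0 b0 \<noteq> 0" unfolding \<phi>_0 by auto
  have m0L: "\<phi> m0 \<in> L" using m0 unfolding L_def by blast
  have "\<exists>g. g \<noteq> 0 \<and> (\<forall>b\<in>Basis. pure_tensor g b \<in> L)"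
    by (rule contains_pure_tensors[of L ?h "\<phi> m0" b0])
      (fact L_add L_mult L_supp L_gen coord_nonzero m0L b0)+
  then obtain g where g: "g \<noteq> 0" "\<And>b. b \<in> Basis \<Longrightarrow> pure_tensor g b \<in> L" by blast
  have L_multiples: "(\<lambda>b. if b \<in> Basis then to_fract (a b) * g else 0) \<in> L" for a
  proof -
    have L0: "(\<lambda>b. 0) \<in> L" using M.subspace_0[OF sub] \<phi>_0 unfolding L_def by (metis imageI)
    have "(\<lambda>c. \<Sum>b\<in>B. to_fract (a b) * pure_tensor g b c) \<in> L" if "finite B" "B \<subseteq> Basis" for B
      using that by (induction B) (auto simp: L0 intro!: L_add L_mult g)
    from this[OF finite_Basis order_refl] show ?thesis
      using finite_Basis by (simp add: pure_tensor_def representation_Basis fconst_hom if_distrib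
          cong: if_cong sum.cong)
  qed
  \<comment> \<open>As a coefficient of an element in the image of \<phi>, g lies in the chart ring,
    so some g h^k is an element a of A.\<close>
  obtain b where "b \<in> Basis" using b0 L_supp \<open>\<phi> m0 \<in> L\<close> by blast
  then obtain m where "\<phi> m = pure_tensor g b" using g(2) unfolding L_def by force
  moreover have "pure_tensor g b b = g"
    using \<open>b \<in> Basis\<close> by (simp add: pure_tensor_def representation_Basis fconst_hom)
  ultimately have "g \<in> chart_ring h"
    using \<phi>_space[of m] \<open>b \<in> Basis\<close> unfolding tensor_space_def by force
  then obtain a k where ak: "g * to_fract ?h ^ k = to_fract a" by (rule chart_ringE)
  have "a \<noteq> 0" using ak g(1) by (auto simp: coord_nonzero)
  \<comment> \<open>h^K clears the denominators of all coefficients of \<phi> m, and a = g h^k in F.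
    So each coefficient of \<phi> (h^K a m) is an element of A times g; \<open>L_multiples\<close>
    and injectivity put h^K a m into N.\<close>
  have clear: "\<exists>n. scaleM (?h ^ n * a) m \<in> N" for m
  proof -
    have "\<forall>b\<in>Basis. \<exists>p. \<phi> m b * to_fract ?h ^ fst p = to_fract (snd p)"
    proof
      fix b assume "b \<in> Basis"
      then have "\<phi> m b \<in> chart_ring h" using \<phi>_space[of m] by (simp add: tensor_space_def)
      then obtain a' n where "\<phi> m b * to_fract ?h ^ n = to_fract a'" by (rule chart_ringE)
      then show "\<exists>p. \<phi> m b * to_fract ?h ^ fst p = to_fract (snd p)" by (intro exI[of _ "(n, a')"]) simp
    qed
    from bchoice[OF this] obtain p where
      p: "\<forall>b\<in>Basis. \<phi> m b * to_fract ?h ^ fst (p b) = to_fract (snd (p b))" by (elim exE)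
    define n where "n = (\<lambda>b. fst (p b))"
    define a' where "a' = (\<lambda>b. snd (p b))"
    have na: "\<phi> m b * to_fract ?h ^ n b = to_fract (a' b)" if "b \<in> Basis" for b
      using p that by (simp add: n_def a'_def)
    define K where "K = (\<Sum>b\<in>Basis. n b)"
    define a'' where "a'' = (\<lambda>b. ?h ^ (K - n b) * a' b * ?h ^ k)"
    have "\<phi> (scaleM (?h ^ K * a) m) b = (if b \<in> Basis then to_fract (a'' b) * g else 0)" for b
    proof (cases "b \<in> Basis")
      case True
      have "n b \<le> K" unfolding K_def using True finite_Basis by (intro member_le_sum) auto
      then have "?h ^ K = ?h ^ n b * ?h ^ (K - n b)" by (simp add: power_add[symmetric])
      then have "\<phi> (scaleM (?h ^ K * a) m) b
          = (\<phi> m b * to_fract ?h ^ n b) * to_fract ?h ^ (K - n b) * (g * to_fract ?h ^ k)"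
        by (simp add: \<phi>_scale ak to_fract_power mult_ac)
      also have "\<dots> = to_fract (a'' b) * g"
        by (simp add: na True a''_def to_fract_power mult_ac)
      finally show ?thesis using True by simp
    next
      case False
      then show ?thesis using \<phi>_space[of m] by (simp add: \<phi>_scale tensor_space_def)
    qed
    then have "\<phi> (scaleM (?h ^ K * a) m) = (\<lambda>b. if b \<in> Basis then to_fract (a'' b) * g else 0)"
      by (rule ext)
    then have "\<phi> (scaleM (?h ^ K * a) m) \<in> L" by (simp only: L_multiples)
    then show ?thesis using \<phi>(1) unfolding L_def by (auto dest: injD)
  qed
  have "\<exists>n. \<forall>m. scaleM (?h ^ n m * a) m \<in> N" by (rule choice) (use clear in blast)
  then obtain n where n: "\<forall>m. scaleM (?h ^ n m * a) m \<in> N" by (elim exE)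
  \<comment> \<open>A single exponent that dominates those of the finitely many generators.\<close>
  define f where "f = ?h ^ (\<Sum>s\<in>S. n s) * a"
  have fS: "scaleM f s \<in> N" if s: "s \<in> S" for s
  proof -
    have "n s \<le> (\<Sum>s\<in>S. n s)" using s fg(1) by (intro member_le_sum) auto
    then have "f = ?h ^ ((\<Sum>s\<in>S. n s) - n s) * (?h ^ n s * a)"
      by (simp add: f_def mult.assoc[symmetric] power_add[symmetric])
    then show ?thesis using M.subspace_scale[OF sub spec[OF n, of s]] by (metis M.scale_scale)
  qed
  define J where "J = {f. \<forall>m. scaleM f m \<in> N}"
  have "1 \<in> J"
  proof (rule rot_stable_ideal_contains_one)
    show "f + g \<in> J" if "f \<in> J" "g \<in> J" for f g
      using that M.subspace_add[OF sub] by (simp add: J_def M.scale_left_distrib)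
    show "g * f \<in> J" if "f \<in> J" for f g
      using that M.subspace_scale[OF sub] by (simp add: J_def M.scale_scale[symmetric] del: M.scale_scale)
    show "rot a b f \<in> J" if f: "f \<in> J" for a b f
    proof -
      have "act (rot a b) (scaleM f m) - scaleM f (act (rot a b) m) \<in> N" for m
        using f unfolding J_def by (intro M.subspace_diff sub actN rot_in_vector_fields) auto
      then show ?thesis by (simp add: J_def M.act_Leibniz[OF rot_in_vector_fields])
    qed
    \<comment> \<open>Multiplication by f is A-linear, so it is enough that f maps the generators
      into N.\<close>
    have "M.subspace {m. scaleM f m \<in> N}"
      using sub by (auto simp: M.subspace_def M.scale_right_distrib M.scale_left_commute[of f]
          simp del: M.scale_scale)
    then have "M.span S \<subseteq> {m. scaleM f m \<in> N}" using fS by (intro M.span_minimal) auto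
    then show "f \<in> J" using fg(2) unfolding J_def by auto
    show "f \<noteq> 0" using \<open>a \<noteq> 0\<close> by (simp add: f_def coord_nonzero)
  qed
  then show ?thesis by (auto simp: J_def)
qed

end

theorem theorem13:
  fixes scaleU :: "'k::{alg_closed_field, field_char_0} \<Rightarrow> 'u::ab_group_add \<Rightarrow> 'u"
    and Basis :: "'u set"
    and \<rho> :: "'k^2^2 \<Rightarrow> 'u \<Rightarrow> 'u"
    and scaleM :: "'k sphere \<Rightarrow> 'm::ab_group_add \<Rightarrow> 'm"
    and act :: "('k sphere \<Rightarrow> 'k sphere) \<Rightarrow> 'm \<Rightarrow> 'm"
  assumes "rational_GL2_module scaleU Basis \<rho>"
    and "rational_GL2_module.simple scaleU \<rho>"
    and "rational_GL2_module.tensor_module scaleU Basis \<rho> scaleM act"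
    and "\<exists>m::'m. m \<noteq> 0"
  shows "AV_module.simple scaleM act"
proof -
  interpret simple_GL2_module scaleU Basis \<rho>
    using assms(1,2) by (intro simple_GL2_module.intro simple_GL2_module_axioms.intro)
  obtain S \<phi> where M: "AV_module scaleM act" and S: "finite S" "module.span scaleM S = UNIV"
    and \<phi>: "\<And>h. inj (\<phi> h) \<and> chart_hom scaleM act h (\<phi> h)"
    using assms(3) unfolding tensor_module_def by blast
  have "N = {0} \<or> N = UNIV" if "AV_module.submodule scaleM act N" for N
    using tensor_submodule_trivial[OF M S conjunct1[OF \<phi>] conjunct2[OF \<phi>] that] by blast
  then show ?thesis using assms(4) by (simp add: AV_module.simple_def[OF M])
qed

end
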